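(* Let $\mathsf X$ be a countable set with $\mathcal B=2^{\mathsf X}$, and let $\mathcal P$ and $\mathcal Q$ be nonempty sets of probability measures on $\mathsf X$. Identify a probability measure $R$ on $\mathsf X$ with its probability vector $\theta_R=(R\{x\})_{x\in\mathsf X}\in\ell^1(\mathsf X)$ and put $\Theta_{\mathcal P}=\{\theta_P:P\in\mathcal P\}$. Then $(\mathcal P,\mathcal Q)$ is sequentially testable if and only if $$\theta_Q\notin\overline{\Theta_{\mathcal P}}^{\,\ell^1}\qquad\text{for every }Q\in\mathcal Q,$$ where the closure is taken in the $\ell^1$ norm. Whenever this holds, there is a countable family $(h_m)_{m\ge1}$ of bounded symmetric functions $h_m:\mathsf X^2\to\mathbb R$ such that $\sup_{P\in\mathcal P}\mathbb E_{P^2}h_m\le0$ for every $m$ and every $Q\in\mathcal Q$ satisfies $\mathbb E_{Q^2}h_m>0$ for some $m$. Thus, on a countable discrete sample space, individual finite-block testability of every $Q\in\mathcal Q$ implies that $(\mathcal P,\mathcal Q)$ is sequentially testable.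
   Context: For a probability measure $R$ on $(\mathsf X,\mathcal B)$, $R^n$ and $R^\infty$ denote i.i.d. product laws on $\mathsf X^n$ and $\mathsf X^{\mathbb N}$; $(X_i)_{i\ge1}$ is the coordinate process and $\mathcal F_n=\sigma(X_1,\dots,X_n)$. A sequential test is an $(\mathcal F_n)$-stopping time $\tau$ with values in $\{1,2,\dots\}\cup\{\infty\}$. It is level-$\alpha$ for $\mathcal P$ if $\sup_{P\in\mathcal P}P^\infty(\tau<\infty)\le\alpha$, and has power one against $Q$ if $Q^\infty(\tau<\infty)=1$. The pair $(\mathcal P,\mathcal Q)$ is called sequentially testable if the following equivalent conditions hold: for some $\alpha\in(0,1)$ there is a level-$\alpha$ test with power one against every $Q\in\mathcal Q$; for every $\alpha\in(0,1)$ there is such a test; there is a countable family $(n_m,h_m)_{m\ge1}$ of bounded measurable $h_m:\mathsf X^{n_m}\to\mathbb R$ with $\sup_{P\in\mathcal P}\mathbb E_{P^{n_m}}h_m\le0$ for every $m$ and such that each $Q\in\mathcal Q$ has $\mathbb E_{Q^{n_m}}h_m>0$ for some $m$. $Q$ is individually finite-block testable if there are $n\ge1$ and a bounded measurable $h:\mathsf X^n\to\mathbb R$ with $\sup_{P\in\mathcal P}\mathbb E_{P^n}h\le0<\mathbb E_{Q^n}h$. *)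

theory Defs
  imports "HOL-Probability.Probability"
begin

text \<open>
  The sample space is a measurable space \<open>M\<close>; a set of probability measures on it is a subset of
  \<open>space (prob_algebra M)\<close>.  Coordinates are counted from 0, so \<open>\<omega> i\<close> is the observation
  \<open>X\<^sub>i\<^sub>+\<^sub>1\<close>, and \<open>\<X>\<^sup>n\<close> is the product indexed by \<open>{..<n}\<close>.
\<close>

definition block_space :: "'a measure \<Rightarrow> nat \<Rightarrow> (nat \<Rightarrow> 'a) measure" where
  "block_space R n = Pi\<^sub>M {..<n} (\<lambda>_. R)"

definition path_space :: "'a measure \<Rightarrow> (nat \<Rightarrow> 'a) measure" where
  "path_space R = Pi\<^sub>M UNIV (\<lambda>_. R)"


section \<open>Sequential tests\<close>

text \<open>
  The time index is \<open>enat\<close>, since the library notion of a stopping time uses the same type for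
  the filtration index and the values of the stopping time.  The condition at time \<open>\<infinity>\<close> is vacuous.
\<close>

definition coordinate_filtration :: "'a measure \<Rightarrow> enat \<Rightarrow> (nat \<Rightarrow> 'a) measure" where
  "coordinate_filtration M t =
     sigma (space (path_space M))
       {{\<omega> \<in> space (path_space M). \<omega> i \<in> A} | i A. enat i < t \<and> A \<in> sets M}"

definition sequential_test :: "'a measure \<Rightarrow> ((nat \<Rightarrow> 'a) \<Rightarrow> enat) \<Rightarrow> bool" where
  "sequential_test M \<tau> \<longleftrightarrow>
     stopping_time (coordinate_filtration M) \<tau> \<and> (\<forall>\<omega> \<in> space (path_space M). 1 \<le> \<tau> \<omega>)"

definition stop_prob :: "((nat \<Rightarrow> 'a) \<Rightarrow> enat) \<Rightarrow> 'a measure \<Rightarrow> real" where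
  "stop_prob \<tau> R = measure (path_space R) {\<omega> \<in> space (path_space R). \<tau> \<omega> < \<infinity>}"

definition has_level :: "((nat \<Rightarrow> 'a) \<Rightarrow> enat) \<Rightarrow> real \<Rightarrow> 'a measure set \<Rightarrow> bool" where
  "has_level \<tau> \<alpha> \<PP> \<longleftrightarrow> (\<forall>P\<in>\<PP>. stop_prob \<tau> P \<le> \<alpha>)"

definition has_power_one :: "((nat \<Rightarrow> 'a) \<Rightarrow> enat) \<Rightarrow> 'a measure \<Rightarrow> bool" where
  "has_power_one \<tau> Q \<longleftrightarrow> stop_prob \<tau> Q = 1"

definition testable_at_level ::
    "'a measure \<Rightarrow> 'a measure set \<Rightarrow> 'a measure set \<Rightarrow> real \<Rightarrow> bool" where
  "testable_at_level M \<PP> \<QQ> \<alpha> \<longleftrightarrow>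
     (\<exists>\<tau>. sequential_test M \<tau> \<and> has_level \<tau> \<alpha> \<PP> \<and> (\<forall>Q\<in>\<QQ>. has_power_one \<tau> Q))"


section \<open>Finite-block functions\<close>

definition block_expectation :: "'a measure \<Rightarrow> nat \<Rightarrow> ((nat \<Rightarrow> 'a) \<Rightarrow> real) \<Rightarrow> real" where
  "block_expectation R n h = (\<integral>\<omega>. h \<omega> \<partial>block_space R n)"

definition null_block_function ::
    "'a measure \<Rightarrow> 'a measure set \<Rightarrow> nat \<Rightarrow> ((nat \<Rightarrow> 'a) \<Rightarrow> real) \<Rightarrow> bool" where
  "null_block_function M \<PP> n h \<longleftrightarrow>
     1 \<le> n \<and> h \<in> borel_measurable (block_space M n) \<and> bounded (h ` space (block_space M n)) \<and>
     (\<forall>P\<in>\<PP>. block_expectation P n h \<le> 0)"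

definition individually_block_testable ::
    "'a measure \<Rightarrow> 'a measure set \<Rightarrow> 'a measure \<Rightarrow> bool" where
  "individually_block_testable M \<PP> Q \<longleftrightarrow>
     (\<exists>n h. null_block_function M \<PP> n h \<and> 0 < block_expectation Q n h)"


section \<open>Sequential testability\<close>

text \<open>
  Sequential testability of \<open>(\<PP>, \<QQ>)\<close> is given by three equivalent conditions.  Each is a separate
  predicate, so that no use of one of them relies on the equivalence.
\<close>

definition sequentially_testable_some_level ::
    "'a measure \<Rightarrow> 'a measure set \<Rightarrow> 'a measure set \<Rightarrow> bool" where
  "sequentially_testable_some_level M \<PP> \<QQ> \<longleftrightarrow> (\<exists>\<alpha>\<in>{0<..<1}. testable_at_level M \<PP> \<QQ> \<alpha>)"

definition sequentially_testable_every_level ::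
    "'a measure \<Rightarrow> 'a measure set \<Rightarrow> 'a measure set \<Rightarrow> bool" where
  "sequentially_testable_every_level M \<PP> \<QQ> \<longleftrightarrow> (\<forall>\<alpha>\<in>{0<..<1}. testable_at_level M \<PP> \<QQ> \<alpha>)"

definition sequentially_testable_blocks ::
    "'a measure \<Rightarrow> 'a measure set \<Rightarrow> 'a measure set \<Rightarrow> bool" where
  "sequentially_testable_blocks M \<PP> \<QQ> \<longleftrightarrow>
     (\<exists>(n :: nat \<Rightarrow> nat) (h :: nat \<Rightarrow> (nat \<Rightarrow> 'a) \<Rightarrow> real).
        (\<forall>m. null_block_function M \<PP> (n m) (h m)) \<and>
        (\<forall>Q\<in>\<QQ>. \<exists>m. 0 < block_expectation Q (n m) (h m)))"


section \<open>The space \<open>\<ell>\<^sup>1(X)\<close>\<close>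

text \<open>Real functions on \<open>X\<close> are represented by functions on the whole type vanishing outside \<open>X\<close>.\<close>

definition l1_space :: "'a set \<Rightarrow> ('a \<Rightarrow> real) set" where
  "l1_space X = {f. (\<forall>x. x \<notin> X \<longrightarrow> f x = 0) \<and> (\<lambda>x. \<bar>f x\<bar>) summable_on X}"

definition l1_norm :: "'a set \<Rightarrow> ('a \<Rightarrow> real) \<Rightarrow> real" where
  "l1_norm X f = (\<Sum>\<^sub>\<infinity>x\<in>X. \<bar>f x\<bar>)"

definition l1_dist :: "'a set \<Rightarrow> ('a \<Rightarrow> real) \<Rightarrow> ('a \<Rightarrow> real) \<Rightarrow> real" where
  "l1_dist X f g = l1_norm X (\<lambda>x. f x - g x)"

definition l1_closure :: "'a set \<Rightarrow> ('a \<Rightarrow> real) set \<Rightarrow> ('a \<Rightarrow> real) set" where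
  "l1_closure X S = Metric_space.mtopology (l1_space X) (l1_dist X) closure_of S"

text \<open>For \<open>x\<close> outside \<open>X\<close> the value is 0, because \<open>{x}\<close> is then not measurable.\<close>

definition prob_vector :: "'a measure \<Rightarrow> 'a \<Rightarrow> real" where
  "prob_vector R = (\<lambda>x. measure R {x})"

lemma l1_diff_summable:
  assumes "f \<in> l1_space X" "g \<in> l1_space X"
  shows "(\<lambda>x. \<bar>f x - g x\<bar>) summable_on X"
proof (rule summable_on_comparison_test)
  show "(\<lambda>x. \<bar>f x\<bar> + \<bar>g x\<bar>) summable_on X"
    using assms by (intro summable_on_add) (auto simp: l1_space_def)
qed auto

lemma Metric_space_l1: "Metric_space (l1_space X) (l1_dist X)"
proof
  fix f g h :: "'a \<Rightarrow> real"
  show "0 \<le> l1_dist X f g"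
    unfolding l1_dist_def l1_norm_def by (rule infsum_nonneg) simp
  show "l1_dist X f g = l1_dist X g f"
    unfolding l1_dist_def l1_norm_def by (simp add: abs_minus_commute)
  assume f: "f \<in> l1_space X" and g: "g \<in> l1_space X"
  show "l1_dist X f g = 0 \<longleftrightarrow> f = g"
  proof
    assume "l1_dist X f g = 0"
    then have "\<bar>f x - g x\<bar> = 0" if "x \<in> X" for x
      using nonneg_infsum_le_0D[OF _ l1_diff_summable[OF f g] _ that]
      by (auto simp: l1_dist_def l1_norm_def)
    then show "f = g"
      using f g by (auto simp: l1_space_def fun_eq_iff) (metis)
  qed (simp add: l1_dist_def l1_norm_def)
  assume h: "h \<in> l1_space X"
  have "l1_dist X f h \<le> (\<Sum>\<^sub>\<infinity>x\<in>X. \<bar>f x - g x\<bar> + \<bar>g x - h x\<bar>)"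
    unfolding l1_dist_def l1_norm_def
    by (intro infsum_mono summable_on_add l1_diff_summable f g h) auto
  also have "\<dots> = l1_dist X f g + l1_dist X g h"
    unfolding l1_dist_def l1_norm_def by (intro infsum_add l1_diff_summable f g h)
  finally show "l1_dist X f h \<le> l1_dist X f g + l1_dist X g h" .
qed

lemma prob_vector_in_l1_space:
  assumes "R \<in> space (prob_algebra (count_space X))"
  shows "prob_vector R \<in> l1_space X"
proof -
  interpret prob_space R
    using assms by (simp add: space_prob_algebra)
  have R: "sets R = Pow X"
    using assms by (simp add: space_prob_algebra)
  have "(\<lambda>x. measure R {x}) summable_on X"
  proof (rule nonneg_bdd_above_summable_on)
    have "sum (\<lambda>x. measure R {x}) F \<le> 1" if F: "finite F" "F \<subseteq> X" for F
    proof -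
      have "sum (\<lambda>x. measure R {x}) F = measure R F"
        using F R by (intro finite_measure_eq_sum_singleton[symmetric]) auto
      then show ?thesis by simp
    qed
    then show "bdd_above (sum (\<lambda>x. measure R {x}) ` {F. F \<subseteq> X \<and> finite F})"
      by (intro bdd_aboveI[of _ 1]) auto
  qed simp
  moreover have "measure R {x} = 0" if "x \<notin> X" for x
    using that R by (intro measure_notin_sets) auto
  ultimately show ?thesis
    by (simp add: l1_space_def prob_vector_def)
qed

end

theory Submission
  imports Defs "HOL-Real_Asymp.Real_Asymp"
begin

text \<open>
  Expectations of a bounded function of \<open>n\<close> observations, and stopping probabilities up to time \<open>n\<close>,
  are Lipschitz in the \<open>\<ell>\<^sup>1\<close> distance with a constant of order \<open>n\<close>.  So neither a finite block nor a
  sequential test can detect an alternative in the \<open>\<ell>\<^sup>1\<close> closure of the null.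

  Conversely, on a countable space probability vectors that are close on a large finite set are close in
  \<open>\<ell>\<^sup>1\<close>, so an alternative at positive distance from the null lies in a rational box in finitely many
  coordinates whose enlargement still avoids the null.  There are countably many such boxes.  Each gives
  the kernel \<open>r\<^sup>2 - \<langle>\<delta>\<^sub>x - l, \<delta>\<^sub>y - l\<rangle>\<close> on pairs, with mean \<open>r\<^sup>2 - \<parallel>\<theta>\<^sub>R - l\<parallel>\<^sup>2\<close>.  It also gives the event that
  the empirical frequencies at a large time lie in the doubled box; by Hoeffding's inequality this event
  is rare under the null and likely under the alternative.  The test stops at the first such event, the
  times being chosen so that the null probabilities sum to at most \<open>\<alpha>\<close>.
\<close>

section \<open>The \<open>\<ell>\<^sup>1\<close> closure and block expectations\<close>

text \<open>Turns the topological condition into a uniform gap \<open>\<epsilon>\<close>. Lipschitz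
  bounds produce such a gap, and the construction of boxes starts from it.\<close>

lemma notin_l1_closure_iff:
  assumes "S \<subseteq> l1_space X" "f \<in> l1_space X"
  shows "f \<notin> l1_closure X S \<longleftrightarrow> (\<exists>\<epsilon>>0. \<forall>g\<in>S. \<epsilon> \<le> l1_dist X f g)"
proof -
  interpret Metric_space "l1_space X" "l1_dist X"
    by (rule Metric_space_l1)
  have "f \<in> l1_closure X S \<longleftrightarrow> (\<forall>\<epsilon>>0. \<exists>g\<in>S. l1_dist X f g < \<epsilon>)"
    using assms by (auto simp: l1_closure_def metric_closure_of) (meson subsetD)
  then show ?thesis
    by (meson not_le)
qed

text \<open>Countability makes \<open>R\<close> the measure with density
  \<open>measure R {x}\<close> against counting measure. Boundedness of \<open>f\<close> gives
  absolute summability by comparison with \<open>B\<close> times the probability vector.\<close>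

lemma integral_eq_infsum:
  fixes f :: "'a \<Rightarrow> real"
  assumes "countable X" "R \<in> space (prob_algebra (count_space X))"
    and B: "\<And>x. x \<in> X \<Longrightarrow> \<bar>f x\<bar> \<le> B"
  shows "(\<lambda>x. measure R {x} * f x) summable_on X"
    and "(\<integral>x. f x \<partial>R) = (\<Sum>\<^sub>\<infinity>x\<in>X. measure R {x} * f x)"
proof -
  interpret prob_space R
    using assms by (simp add: space_prob_algebra)
  have R: "sets R = Pow X"
    using assms by (simp add: space_prob_algebra)
  have dens: "R = density (count_space X) (\<lambda>x. ennreal (measure R {x}))"
  proof (rule measure_eqI_countable[OF R _ \<open>countable X\<close>])
    fix a assume a: "a \<in> X"
    have "emeasure (density (count_space X) (\<lambda>x. ennreal (measure R {x}))) {a} =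
      (\<integral>\<^sup>+x. ennreal (measure R {a}) * indicator {a} x \<partial>count_space X)"
      using a by (subst emeasure_density) (auto intro!: nn_integral_cong split: split_indicator)
    also have "\<dots> = ennreal (measure R {a})"
      using a by (subst nn_integral_cmult_indicator) auto
    finally show "emeasure R {a} = emeasure (density (count_space X) (\<lambda>x. ennreal (measure R {x}))) {a}"
      by (simp add: emeasure_eq_measure)
  qed simp
  have "prob_vector R \<in> l1_space X"
    using assms by (intro prob_vector_in_l1_space)
  then have s: "(\<lambda>x. measure R {x} * B) summable_on X"
    by (intro summable_on_cmult_left) (simp add: l1_space_def prob_vector_def)
  have abs: "(\<lambda>x. norm (measure R {x} * f x)) summable_on X"
    by (rule summable_on_comparison_test[OF s]) (auto simp: abs_mult B intro: mult_left_mono)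
  then show sum: "(\<lambda>x. measure R {x} * f x) summable_on X"
    by (rule abs_summable_summable)
  have "(\<integral>x. f x \<partial>R) = (\<integral>x. measure R {x} * f x \<partial>count_space X)"
    by (subst dens, subst integral_density) auto
  also have "\<dots> = infsetsum (\<lambda>x. measure R {x} * f x) X"
    by (simp add: infsetsum_def)
  also have "\<dots> = (\<Sum>\<^sub>\<infinity>x\<in>X. measure R {x} * f x)"
    by (rule infsetsum_infsum) (use abs in \<open>simp only: abs_summable_equivalent\<close>)
  finally show "(\<integral>x. f x \<partial>R) = (\<Sum>\<^sub>\<infinity>x\<in>X. measure R {x} * f x)" .
qed

text \<open>The difference is the sum of \<open>(measure P {x} - measure Q {x}) * f x\<close>, which
  is bounded term by term.\<close>

lemma integral_diff_le_l1_dist: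
  fixes f :: "'a \<Rightarrow> real"
  assumes "countable X"
    and P: "P \<in> space (prob_algebra (count_space X))" and Q: "Q \<in> space (prob_algebra (count_space X))"
    and B: "\<And>x. x \<in> X \<Longrightarrow> \<bar>f x\<bar> \<le> B"
  shows "\<bar>(\<integral>x. f x \<partial>P) - (\<integral>x. f x \<partial>Q)\<bar> \<le> B * l1_dist X (prob_vector P) (prob_vector Q)"
proof -
  have s: "(\<lambda>x. \<bar>prob_vector P x - prob_vector Q x\<bar>) summable_on X"
    using P Q by (intro l1_diff_summable prob_vector_in_l1_space)
  have s': "(\<lambda>x. norm ((measure P {x} - measure Q {x}) * f x)) summable_on X"
    by (rule summable_on_comparison_test[OF summable_on_cmult_left[OF s, of B]])
       (auto simp: abs_mult prob_vector_def B intro: mult_left_mono)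
  note iP = integral_eq_infsum[OF \<open>countable X\<close> P, of f B, OF B]
    and iQ = integral_eq_infsum[OF \<open>countable X\<close> Q, of f B, OF B]
  have "(\<integral>x. f x \<partial>P) = (\<Sum>\<^sub>\<infinity>x\<in>X. measure Q {x} * f x + (measure P {x} - measure Q {x}) * f x)"
    using iP(2) by (simp add: left_diff_distrib)
  also have "\<dots> = (\<integral>x. f x \<partial>Q) + (\<Sum>\<^sub>\<infinity>x\<in>X. (measure P {x} - measure Q {x}) * f x)"
    using infsum_add[OF iQ(1) abs_summable_summable[OF s']] iQ(2) by simp
  finally have "\<bar>(\<integral>x. f x \<partial>P) - (\<integral>x. f x \<partial>Q)\<bar> =
      \<bar>\<Sum>\<^sub>\<infinity>x\<in>X. (measure P {x} - measure Q {x}) * f x\<bar>"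
    by simp
  also have "\<dots> \<le> (\<Sum>\<^sub>\<infinity>x\<in>X. norm ((measure P {x} - measure Q {x}) * f x))"
    using norm_infsum_bound[OF s'] by simp
  also have "\<dots> \<le> (\<Sum>\<^sub>\<infinity>x\<in>X. \<bar>prob_vector P x - prob_vector Q x\<bar> * B)"
    by (rule infsum_mono[OF s' summable_on_cmult_left[OF s, of B]])
       (auto simp: abs_mult prob_vector_def B intro: mult_left_mono)
  also have "\<dots> = B * l1_dist X (prob_vector P) (prob_vector Q)"
    unfolding l1_dist_def l1_norm_def by (subst infsum_cmult_left) (auto simp: s mult.commute)
  finally show ?thesis .
qed

section \<open>Product laws on blocks and integrating out the last observation\<close>

lemma sets_block_space:
  assumes "R \<in> space (prob_algebra M)"
  shows "sets (block_space R n) = sets (block_space M n)"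
  unfolding block_space_def by (rule sets_PiM_cong) (use assms in \<open>auto simp: space_prob_algebra\<close>)

lemma sets_path_space:
  assumes "R \<in> space (prob_algebra M)"
  shows "sets (path_space R) = sets (path_space M)"
  unfolding path_space_def by (rule sets_PiM_cong) (use assms in \<open>auto simp: space_prob_algebra\<close>)

lemma prob_space_block_space:
  "R \<in> space (prob_algebra M) \<Longrightarrow> prob_space (block_space R n)"
  unfolding block_space_def by (rule prob_space_PiM) (simp add: space_prob_algebra)

lemma prob_space_path_space:
  "R \<in> space (prob_algebra M) \<Longrightarrow> prob_space (path_space R)"
  unfolding path_space_def by (rule prob_space_PiM) (simp add: space_prob_algebra)

lemma measurable_block_update:
  "(\<lambda>(\<omega>, x). fun_upd \<omega> n x) \<in> block_space M n \<Otimes>\<^sub>M M \<rightarrow>\<^sub>M block_space M (Suc n)"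
  unfolding block_space_def lessThan_Suc by (rule measurable_add_dim)

text \<open>Fubini in the last coordinate. Measurability and boundedness refer to \<open>M\<close>
  rather than \<open>R\<close>, so one \<open>h\<close> serves several laws; the inner integral
  again satisfies both with the same \<open>B\<close>, which lets an induction on \<open>n\<close>
  run.\<close>

lemma block_expectation_Suc:
  assumes R: "R \<in> space (prob_algebra M)"
    and h: "h \<in> borel_measurable (block_space M (Suc n))"
    and B: "\<And>\<omega>. \<omega> \<in> space (block_space M (Suc n)) \<Longrightarrow> \<bar>h \<omega>\<bar> \<le> B"
  shows "block_expectation R (Suc n) h = block_expectation R n (\<lambda>\<omega>. \<integral>x. h (fun_upd \<omega> n x) \<partial>R)"
    and "(\<lambda>\<omega>. \<integral>x. h (fun_upd \<omega> n x) \<partial>R) \<in> borel_measurable (block_space M n)"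
    and "\<And>\<omega>. \<omega> \<in> space (block_space M n) \<Longrightarrow> \<bar>\<integral>x. h (fun_upd \<omega> n x) \<partial>R\<bar> \<le> B"
proof -
  interpret prob_space R
    using R by (simp add: space_prob_algebra)
  interpret product_sigma_finite "\<lambda>_::nat. R" ..
  interpret b: prob_space "block_space R (Suc n)"
    by (rule prob_space_block_space[OF R])
  have setsR: "sets R = sets M"
    using R by (simp add: space_prob_algebra)
  note sb = sets_block_space[OF R]
  have "integrable (block_space R (Suc n)) h"
  proof (rule b.integrable_const_bound)
    show "AE x in block_space R (Suc n). norm (h x) \<le> B"
      using B sets_eq_imp_space_eq[OF sb] by (intro AE_I2) auto
    show "h \<in> borel_measurable (block_space R (Suc n))"
      using h measurable_cong_sets[OF sb refl] by blast
  qed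
  then show "block_expectation R (Suc n) h = block_expectation R n (\<lambda>\<omega>. \<integral>x. h (fun_upd \<omega> n x) \<partial>R)"
    unfolding block_expectation_def block_space_def lessThan_Suc
    by (intro product_integral_insert) auto
  have upd: "(\<lambda>(\<omega>, x). h (fun_upd \<omega> n x)) \<in> borel_measurable (block_space M n \<Otimes>\<^sub>M M)"
    using measurable_compose[OF measurable_block_update h] by (simp add: case_prod_beta')
  then have upd': "(\<lambda>(\<omega>, x). h (fun_upd \<omega> n x)) \<in> borel_measurable (block_space M n \<Otimes>\<^sub>M R)"
    using measurable_cong_sets[OF sets_pair_measure_cong[OF refl setsR] refl] by blast
  then show "(\<lambda>\<omega>. \<integral>x. h (fun_upd \<omega> n x) \<partial>R) \<in> borel_measurable (block_space M n)"
    by (rule borel_measurable_lebesgue_integral)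
  fix \<omega> assume \<omega>: "\<omega> \<in> space (block_space M n)"
  have bd: "\<bar>h (fun_upd \<omega> n x)\<bar> \<le> B" if "x \<in> space R" for x
  proof (rule B)
    show "fun_upd \<omega> n x \<in> space (block_space M (Suc n))"
      using measurable_space[OF measurable_block_update[of n M], of "(\<omega>, x)"] \<omega> that
        sets_eq_imp_space_eq[OF setsR] by (simp add: space_pair_measure)
  qed
  have "integrable R (\<lambda>x. h (fun_upd \<omega> n x))"
    using measurable_Pair2[OF upd' \<omega>] bd by (intro integrable_const_bound[of _ B]) auto
  then have "\<bar>\<integral>x. h (fun_upd \<omega> n x) \<partial>R\<bar> \<le> (\<integral>x. B \<partial>R)"
    using bd by (intro order_trans[OF integral_abs_bound] integral_mono) auto
  then show "\<bar>\<integral>x. h (fun_upd \<omega> n x) \<partial>R\<bar> \<le> B"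
    by (simp add: prob_space)
qed

text \<open>The law is exchanged one observation at a time, starting with the last; each exchange
  costs at most \<open>B\<close> times the distance.\<close>

lemma block_expectation_diff_le_l1_dist:
  assumes "countable X"
    and P: "P \<in> space (prob_algebra (count_space X))" and Q: "Q \<in> space (prob_algebra (count_space X))"
    and "h \<in> borel_measurable (block_space (count_space X) n)"
    and "\<And>\<omega>. \<omega> \<in> space (block_space (count_space X) n) \<Longrightarrow> \<bar>h \<omega>\<bar> \<le> B"
  shows "\<bar>block_expectation P n h - block_expectation Q n h\<bar> \<le>
    n * (B * l1_dist X (prob_vector P) (prob_vector Q))"
  using assms(4,5)
proof (induction n arbitrary: h)
  case 0
  then show ?case
    by (simp add: block_expectation_def block_space_def PiM_empty)
next
  case (Suc n)
  let ?d = "B * l1_dist X (prob_vector P) (prob_vector Q)"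
  let ?g = "\<lambda>R \<omega>. \<integral>x. h (fun_upd \<omega> n x) \<partial>R"
  note gP = block_expectation_Suc[OF P Suc.prems] and gQ = block_expectation_Suc[OF Q Suc.prems]
  interpret b: prob_space "block_space P n"
    by (rule prob_space_block_space[OF P])
  note sb = sets_block_space[OF P]
  have int: "integrable (block_space P n) g"
    if "g \<in> borel_measurable (block_space (count_space X) n)"
      "\<And>\<omega>. \<omega> \<in> space (block_space (count_space X) n) \<Longrightarrow> \<bar>g \<omega>\<bar> \<le> B" for g
    using that measurable_cong_sets[OF sb refl] sets_eq_imp_space_eq[OF sb]
    by (intro b.integrable_const_bound[of _ B] AE_I2) auto
  have *: "\<bar>?g P \<omega> - ?g Q \<omega>\<bar> \<le> ?d" if "\<omega> \<in> space (block_space P n)" for \<omega>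
  proof (rule integral_diff_le_l1_dist[OF assms(1) P Q])
    fix x assume "x \<in> X"
    then have "fun_upd \<omega> n x \<in> space (block_space (count_space X) (Suc n))"
      using measurable_space[OF measurable_block_update[of n "count_space X"], of "(\<omega>, x)"] that
        sets_eq_imp_space_eq[OF sb] by (simp add: space_pair_measure)
    then show "\<bar>h (fun_upd \<omega> n x)\<bar> \<le> B"
      by (rule Suc.prems)
  qed
  \<comment> \<open>The intermediate term \<open>block_expectation P n (?g Q)\<close> has the last
    observation drawn from \<open>Q\<close> and the others from \<open>P\<close>. The induction
    hypothesis then exchanges those others.\<close>
  have "\<bar>block_expectation P n (?g P) - block_expectation P n (?g Q)\<bar> =
      \<bar>\<integral>\<omega>. ?g P \<omega> - ?g Q \<omega> \<partial>block_space P n\<bar>"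
    unfolding block_expectation_def by (simp add: int gP gQ)
  also have "\<dots> \<le> (\<integral>\<omega>. ?d \<partial>block_space P n)"
    by (intro order_trans[OF integral_abs_bound] integral_mono integrable_abs
        Bochner_Integration.integrable_diff int gP gQ b.integrable_const *)
  also have "\<dots> = ?d"
    by (simp add: b.prob_space)
  finally have "\<bar>block_expectation P n (?g P) - block_expectation P n (?g Q)\<bar> \<le> ?d" .
  moreover have "\<bar>block_expectation P n (?g Q) - block_expectation Q n (?g Q)\<bar> \<le> n * ?d"
    by (rule Suc.IH[OF gQ(2,3)])
  moreover have "real (Suc n) * ?d = n * ?d + ?d"
    by (simp add: algebra_simps)
  ultimately show ?case
    using gP(1) gQ(1) by linarith
qed

text \<open>The expectation of \<open>h\<close> must drop from a positive value under
  \<open>Q\<close> to at most 0 under each null law, and the Lipschitz bound converts this drop into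
  a distance.\<close>

lemma individually_block_testable_imp_notin_l1_closure:
  assumes "countable X" and \<PP>: "\<PP> \<subseteq> space (prob_algebra (count_space X))"
    and Q: "Q \<in> space (prob_algebra (count_space X))"
    and "individually_block_testable (count_space X) \<PP> Q"
  shows "prob_vector Q \<notin> l1_closure X (prob_vector ` \<PP>)"
proof -
  obtain n h where h: "null_block_function (count_space X) \<PP> n h" and pos: "0 < block_expectation Q n h"
    using assms(4) unfolding individually_block_testable_def by blast
  obtain B where "\<forall>y\<in>h ` space (block_space (count_space X) n). \<bar>y\<bar> \<le> B"
    using h unfolding null_block_function_def bounded_iff real_norm_def by blast
  \<comment> \<open>Taking \<open>max 1 B\<close> keeps the denominator of \<open>\<epsilon>\<close>
    positive without a case distinction on \<open>B\<close>.\<close>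
  then have B: "\<bar>h \<omega>\<bar> \<le> max 1 B" if "\<omega> \<in> space (block_space (count_space X) n)" for \<omega>
    using that by force
  have n: "n \<ge> 1" and hm: "h \<in> borel_measurable (block_space (count_space X) n)"
    using h unfolding null_block_function_def by auto
  define \<epsilon> where "\<epsilon> = block_expectation Q n h / (n * max 1 B)"
  have np: "0 < n * max 1 B"
    using n by simp
  have "\<epsilon> \<le> l1_dist X (prob_vector Q) (prob_vector P)" if "P \<in> \<PP>" for P
  proof -
    have "block_expectation P n h \<le> 0"
      using h that unfolding null_block_function_def by blast
    then have "block_expectation Q n h \<le> n * (max 1 B * l1_dist X (prob_vector Q) (prob_vector P))"
      using block_expectation_diff_le_l1_dist[OF assms(1) Q _ hm B] that \<PP> by fastforce
    then show ?thesis
      using np by (simp add: \<epsilon>_def pos_divide_le_eq mult_ac)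
  qed
  moreover have "0 < \<epsilon>"
    using pos np by (simp add: \<epsilon>_def)
  ultimately show ?thesis
    using prob_vector_in_l1_space \<PP> Q by (subst notin_l1_closure_iff) auto
qed

section \<open>The coordinate filtration and sequential tests\<close>

lemma space_coordinate_filtration [simp]:
  "space (coordinate_filtration M t) = space (path_space M)"
  unfolding coordinate_filtration_def by (rule space_measure_of) auto

lemma sets_coordinate_filtration:
  "sets (coordinate_filtration M t) = sigma_sets (space (path_space M))
    {{\<omega> \<in> space (path_space M). \<omega> i \<in> A} | i A. enat i < t \<and> A \<in> sets M}"
  unfolding coordinate_filtration_def by (rule sets_measure_of) auto

lemma sets_coordinate_filtration_mono:
  assumes "s \<le> t"
  shows "sets (coordinate_filtration M s) \<subseteq> sets (coordinate_filtration M t)"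
  unfolding sets_coordinate_filtration
  by (rule sigma_sets_mono') (use assms in \<open>auto intro: less_le_trans\<close>)

lemma sets_coordinate_filtration_le:
  "sets (coordinate_filtration M t) \<subseteq> sets (path_space M)"
proof -
  have "{\<omega> \<in> space (path_space M). \<omega> i \<in> A} \<in> sets (path_space M)" if "A \<in> sets M" for i A
    using that unfolding path_space_def by (intro sets_Collect_single) auto
  then show ?thesis
    unfolding sets_coordinate_filtration by (intro sets.sigma_sets_subset) auto
qed

lemma measurable_coordinate:
  assumes "i < n"
  shows "(\<lambda>\<omega>. \<omega> i) \<in> coordinate_filtration M (enat n) \<rightarrow>\<^sub>M M"
proof (rule measurableI)
  fix A assume "A \<in> sets M"
  moreover have "(\<lambda>\<omega>. \<omega> i) -` A \<inter> space (coordinate_filtration M (enat n)) =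
      {\<omega> \<in> space (path_space M). \<omega> i \<in> A}"
    by auto
  ultimately show "(\<lambda>\<omega>. \<omega> i) -` A \<inter> space (coordinate_filtration M (enat n)) \<in>
      sets (coordinate_filtration M (enat n))"
    using assms unfolding sets_coordinate_filtration by (auto intro!: sigma_sets.Basic)
qed (auto simp: path_space_def space_PiM PiE_iff)

text \<open>Every generator at time \<open>n\<close> is a preimage under restriction to
  \<open>{..<n}\<close>, so the whole sigma-algebra lies in the one generated by that
  restriction.\<close>

lemma coordinate_filtration_cylinder:
  assumes "S \<in> sets (coordinate_filtration M (enat n))"
  shows "\<exists>A\<in>sets (block_space M n). S = prod_emb UNIV (\<lambda>_. M) {..<n} A"
proof -
  have restr: "(\<lambda>\<omega>. restrict \<omega> {..<n}) \<in> path_space M \<rightarrow>\<^sub>M block_space M n"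
    unfolding path_space_def block_space_def by (rule measurable_restrict_subset) simp
  let ?V = "vimage_algebra (space (path_space M)) (\<lambda>\<omega>. restrict \<omega> {..<n}) (block_space M n)"
  have "{\<omega> \<in> space (path_space M). \<omega> i \<in> A} \<in> sets ?V" if "enat i < enat n" "A \<in> sets M" for i A
  proof -
    have "i < n"
      using that by simp
    have "{\<omega> \<in> space (path_space M). \<omega> i \<in> A} =
        (\<lambda>\<omega>. restrict \<omega> {..<n}) -` {\<omega> \<in> space (block_space M n). \<omega> i \<in> A} \<inter> space (path_space M)"
      using measurable_space[OF restr] \<open>i < n\<close> by auto
    also have "\<dots> \<in> sets ?V"
      unfolding block_space_def
      by (rule in_vimage_algebra, rule sets_Collect_single) (use \<open>i < n\<close> that in auto)
    finally show ?thesis .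
  qed
  then have "{{\<omega> \<in> space (path_space M). \<omega> i \<in> A} | i A. enat i < enat n \<and> A \<in> sets M} \<subseteq> sets ?V"
    by blast
  then have "sigma_sets (space ?V) {{\<omega> \<in> space (path_space M). \<omega> i \<in> A} | i A. enat i < enat n \<and> A \<in> sets M} \<subseteq> sets ?V"
    by (rule sets.sigma_sets_subset)
  then have "S \<in> sets ?V"
    using assms by (simp only: sets_coordinate_filtration space_vimage_algebra subset_iff)
  moreover have "(\<lambda>\<omega>. restrict \<omega> {..<n}) \<in> space (path_space M) \<rightarrow> space (block_space M n)"
    using measurable_space[OF restr] by blast
  ultimately obtain A where "A \<in> sets (block_space M n)"
    "S = (\<lambda>\<omega>. restrict \<omega> {..<n}) -` A \<inter> space (path_space M)"
    by (auto simp only: sets_vimage_algebra2)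
  then show ?thesis
    by (intro bexI[of _ A]) (simp_all add: prod_emb_def path_space_def space_PiM)
qed

text \<open>The finite-dimensional marginals of the infinite product are the finite products. This
  carries the block estimates over to events on path space.\<close>

lemma measure_path_space_cylinder:
  assumes R: "R \<in> space (prob_algebra M)" and A: "A \<in> sets (block_space M n)"
  shows "measure (path_space R) (prod_emb UNIV (\<lambda>_. M) {..<n} A) = block_expectation R n (indicator A)"
proof -
  interpret prob_space R
    using R by (simp add: space_prob_algebra)
  interpret product_prob_space "\<lambda>_::nat. R" UNIV ..
  have space: "space R = space M"
    using R sets_eq_imp_space_eq by (auto simp: space_prob_algebra)
  have A': "A \<in> sets (block_space R n)"
    using A sets_block_space[OF R] by simp
  have "prod_emb UNIV (\<lambda>_. M) {..<n} A = prod_emb UNIV (\<lambda>_. R) {..<n} A"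
    by (simp add: prod_emb_def space)
  moreover have "emeasure (path_space R) (prod_emb UNIV (\<lambda>_. R) {..<n} A) = emeasure (block_space R n) A"
    using A' unfolding path_space_def block_space_def by (intro emeasure_PiM_emb') auto
  moreover have "A \<inter> space (block_space R n) = A"
    using sets.sets_into_space[OF A'] by auto
  ultimately show ?thesis
    unfolding block_expectation_def measure_def by (simp add: measure_def)
qed

section \<open>Stopping probabilities at limit points of the null\<close>

lemma path_space_diff_le_l1_dist:
  assumes "countable X"
    and P: "P \<in> space (prob_algebra (count_space X))" and Q: "Q \<in> space (prob_algebra (count_space X))"
    and S: "S \<in> sets (coordinate_filtration (count_space X) (enat n))"
  shows "\<bar>measure (path_space P) S - measure (path_space Q) S\<bar> \<le>
    n * l1_dist X (prob_vector P) (prob_vector Q)"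
proof -
  obtain A where A: "A \<in> sets (block_space (count_space X) n)"
    and S_eq: "S = prod_emb UNIV (\<lambda>_. count_space X) {..<n} A"
    using coordinate_filtration_cylinder[OF S] by blast
  show ?thesis
    using block_expectation_diff_le_l1_dist[OF assms(1) P Q, of "indicator A" n 1] A
    unfolding S_eq measure_path_space_cylinder[OF P A] measure_path_space_cylinder[OF Q A]
    by (simp add: indicator_def)
qed

text \<open>For a fixed horizon \<open>n\<close>, null laws tending to \<open>Q\<close> transfer the
  bound \<open>\<alpha>\<close> to the event of stopping by time \<open>n\<close>. The horizon goes
  to infinity only afterwards, so the growth of the Lipschitz constant with \<open>n\<close> does no
  harm.\<close>

lemma stop_prob_le_of_l1_closure:
  assumes "countable X" and \<PP>: "\<PP> \<subseteq> space (prob_algebra (count_space X))"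
    and Q: "Q \<in> space (prob_algebra (count_space X))"
    and cl: "prob_vector Q \<in> l1_closure X (prob_vector ` \<PP>)"
    and \<tau>: "sequential_test (count_space X) \<tau>" and lev: "has_level \<tau> \<alpha> \<PP>"
  shows "stop_prob \<tau> Q \<le> \<alpha>"
proof -
  let ?M = "count_space X"
  define S where "S n = {\<omega> \<in> space (path_space ?M). \<tau> \<omega> \<le> enat n}" for n
  have S: "S n \<in> sets (coordinate_filtration ?M (enat n))" for n
    using \<tau> unfolding sequential_test_def stopping_time_def S_def pred_def by auto
  have S': "S n \<in> sets (path_space R)" if "R \<in> space (prob_algebra ?M)" for n R
    using S sets_coordinate_filtration_le sets_path_space[OF that] by blast
  have space: "space (path_space R) = space (path_space ?M)" if "R \<in> space (prob_algebra ?M)" for R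
    by (rule sets_eq_imp_space_eq[OF sets_path_space[OF that]])
  have Un: "(\<Union>n. S n) = {\<omega> \<in> space (path_space ?M). \<tau> \<omega> < \<infinity>}"
  proof -
    have "(\<exists>n. t \<le> enat n) \<longleftrightarrow> t < \<infinity>" for t
      by (cases t) auto
    then show ?thesis
      by (auto simp: S_def)
  qed
  have stop: "stop_prob \<tau> R = measure (path_space R) (\<Union>n. S n)" if "R \<in> space (prob_algebra ?M)" for R
    by (simp only: stop_prob_def Un space[OF that])
  have "measure (path_space Q) (S n) \<le> \<alpha>" for n
  proof (rule field_le_epsilon)
    fix e :: real assume "e > 0"
    \<comment> \<open>The null law is chosen depending on \<open>n\<close>, close enough that the
      constant \<open>n\<close> times its distance stays below \<open>e\<close>; the added 1 covers
      \<open>n = 0\<close>.\<close>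
    then have pos: "e / (real n + 1) > 0"
      by simp
    obtain P where P: "P \<in> \<PP>" and d: "l1_dist X (prob_vector Q) (prob_vector P) < e / (real n + 1)"
      using cl pos notin_l1_closure_iff[of "prob_vector ` \<PP>" X "prob_vector Q"] prob_vector_in_l1_space \<PP> Q
      by (fastforce simp: not_le)
    have P': "P \<in> space (prob_algebra ?M)"
      using P \<PP> by auto
    interpret p: prob_space "path_space P"
      by (rule prob_space_path_space[OF P'])
    have "measure (path_space P) (S n) \<le> measure (path_space P) (\<Union>n. S n)"
      using S'[OF P'] by (intro p.finite_measure_mono) auto
    also have "\<dots> \<le> \<alpha>"
      using lev P by (simp add: has_level_def stop[OF P', symmetric])
    finally have "measure (path_space P) (S n) \<le> \<alpha>" .
    moreover have "measure (path_space Q) (S n) - measure (path_space P) (S n) \<le>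
        n * l1_dist X (prob_vector Q) (prob_vector P)"
      using path_space_diff_le_l1_dist[OF assms(1) Q P' S] abs_le_D1 by blast
    moreover have "n * l1_dist X (prob_vector Q) (prob_vector P) \<le> n * (e / (real n + 1))"
      using d by (intro mult_left_mono) auto
    moreover have "n * (e / (real n + 1)) \<le> e"
      using \<open>e > 0\<close> by (simp add: field_simps)
    ultimately show "measure (path_space Q) (S n) \<le> \<alpha> + e"
      by linarith
  qed
  moreover interpret q: prob_space "path_space Q"
    by (rule prob_space_path_space[OF Q])
  have "(\<lambda>n. measure (path_space Q) (S n)) \<longlonglongrightarrow> measure (path_space Q) (\<Union>n. S n)"
    using S'[OF Q]
    by (intro q.finite_Lim_measure_incseq incseq_SucI) (auto simp: S_def intro: order_trans)
  ultimately have "measure (path_space Q) (\<Union>n. S n) \<le> \<alpha>"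
    by (intro LIMSEQ_le_const2) auto
  then show ?thesis
    by (simp add: stop[OF Q])
qed

text \<open>The test stops at the earliest time \<open>k m\<close> whose event \<open>A m\<close>
  occurs, so stopping in finite time is the union of the \<open>A m\<close>. Its null probability is
  at most the geometric series \<open>\<alpha> / 2 ^ Suc m\<close>, with sum
  \<open>\<alpha>\<close>; under an alternative it dominates each single \<open>A m\<close>.\<close>

lemma testable_at_levelI:
  assumes \<PP>: "\<PP> \<subseteq> space (prob_algebra M)" and \<QQ>: "\<QQ> \<subseteq> space (prob_algebra M)"
    and k: "\<And>m. 1 \<le> k m" and A: "\<And>m. A m \<in> sets (coordinate_filtration M (enat (k m)))"
    and level: "\<And>P m. P \<in> \<PP> \<Longrightarrow> measure (path_space P) (A m) \<le> \<alpha> / 2 ^ Suc m"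
    and power: "\<And>Q \<delta>. Q \<in> \<QQ> \<Longrightarrow> \<delta> > 0 \<Longrightarrow> \<exists>m. 1 - \<delta> \<le> measure (path_space Q) (A m)"
  shows "testable_at_level M \<PP> \<QQ> \<alpha>"
proof -
  \<comment> \<open>The infimum runs over times because \<open>k\<close> need not be monotone. The
    infimum of the empty set is \<infinity>, the right value when no event occurs.\<close>
  define \<tau> where "\<tau> \<omega> = Inf {enat (k m) | m. \<omega> \<in> A m}" for \<omega>
  have le_iff: "\<tau> \<omega> \<le> enat t \<longleftrightarrow> (\<exists>m. \<omega> \<in> A m \<and> k m \<le> t)" for \<omega> t
  proof
    assume le: "\<tau> \<omega> \<le> enat t"
    have "{enat (k m) | m. \<omega> \<in> A m} \<noteq> {}"
    proof
      assume empty: "{enat (k m) | m. \<omega> \<in> A m} = {}"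
      have "\<tau> \<omega> = \<infinity>"
        unfolding \<tau>_def empty Inf_enat_def by simp
      with le show False
        by simp
    qed
    then have "\<tau> \<omega> \<in> {enat (k m) | m. \<omega> \<in> A m}"
      unfolding \<tau>_def by (meson all_not_in_conv wellorder_InfI)
    then show "\<exists>m. \<omega> \<in> A m \<and> k m \<le> t"
      using le by auto
  next
    assume "\<exists>m. \<omega> \<in> A m \<and> k m \<le> t"
    then obtain m where "\<omega> \<in> A m" "k m \<le> t" by blast
    then show "\<tau> \<omega> \<le> enat t"
      unfolding \<tau>_def by (intro Inf_lower2[of "enat (k m)"]) auto
  qed
  have A': "A m \<in> sets (path_space R)" if "R \<in> space (prob_algebra M)" for m R
    using A[of m] sets_coordinate_filtration_le sets_path_space[OF that] by blast
  have space: "space (path_space R) = space (path_space M)" if "R \<in> space (prob_algebra M)" for R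
    by (rule sets_eq_imp_space_eq[OF sets_path_space[OF that]])
  have sub: "A m \<subseteq> space (path_space M)" for m
    using sets.sets_into_space[OF A[of m]] by simp
  have stop: "stop_prob \<tau> R = measure (path_space R) (\<Union>m. A m)" if "R \<in> space (prob_algebra M)" for R
  proof -
    have "\<tau> \<omega> < \<infinity> \<longleftrightarrow> (\<exists>t. \<tau> \<omega> \<le> enat t)" for \<omega>
      by (cases "\<tau> \<omega>") auto
    then have "{\<omega> \<in> space (path_space R). \<tau> \<omega> < \<infinity>} = (\<Union>m. A m)"
      using sub by (auto simp: le_iff space[OF that])
    then show ?thesis
      by (simp add: stop_prob_def)
  qed
  have "stopping_time (coordinate_filtration M) \<tau>"
    unfolding stopping_time_def
  proof
    fix t
    show "Measurable.pred (coordinate_filtration M t) (\<lambda>\<omega>. \<tau> \<omega> \<le> t)"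
    proof (cases t)
      case (enat n)
      have "{\<omega> \<in> space (path_space M). \<tau> \<omega> \<le> t} = (\<Union>m\<in>{m. k m \<le> n}. A m)"
        using sub by (auto simp: enat le_iff)
      moreover have "A m \<in> sets (coordinate_filtration M t)" if "k m \<le> n" for m
        using A[of m] sets_coordinate_filtration_mono[of "enat (k m)" t M] that by (auto simp: enat)
      ultimately show ?thesis
        by (auto simp: pred_def)
    qed simp
  qed
  moreover have "1 \<le> \<tau> \<omega>" for \<omega>
    unfolding \<tau>_def using k by (intro Inf_greatest) (auto simp: one_enat_def)
  moreover have "has_level \<tau> \<alpha> \<PP>"
    unfolding has_level_def
  proof
    fix P assume P: "P \<in> \<PP>"
    then have P': "P \<in> space (prob_algebra M)"
      using \<PP> by auto
    interpret p: prob_space "path_space P"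
      by (rule prob_space_path_space[OF P'])
    have sums: "(\<lambda>m. \<alpha> / 2 ^ Suc m) sums \<alpha>"
      using sums_mult[OF power_half_series, of \<alpha>] by (simp add: power_one_over)
    then have s: "summable (\<lambda>m. measure (path_space P) (A m))"
      by (intro summable_comparison_test'[OF sums_summable[OF sums]]) (use level[OF P] in auto)
    have "measure (path_space P) (\<Union>m. A m) \<le> (\<Sum>m. measure (path_space P) (A m))"
      using A'[OF P'] s by (intro p.finite_measure_subadditive_countably) auto
    also have "\<dots> \<le> (\<Sum>m. \<alpha> / 2 ^ Suc m)"
      by (intro suminf_le level[OF P] s sums_summable[OF sums])
    also have "\<dots> = \<alpha>"
      using sums by (simp add: sums_iff)
    finally show "stop_prob \<tau> P \<le> \<alpha>"
      by (simp add: stop[OF P'])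
  qed
  moreover have "has_power_one \<tau> Q" if Q: "Q \<in> \<QQ>" for Q
  proof -
    have Q': "Q \<in> space (prob_algebra M)"
      using Q \<QQ> by auto
    interpret q: prob_space "path_space Q"
      by (rule prob_space_path_space[OF Q'])
    have "1 \<le> measure (path_space Q) (\<Union>m. A m)"
    proof (rule field_le_epsilon)
      fix e :: real assume "e > 0"
      then obtain m where "1 - e \<le> measure (path_space Q) (A m)"
        using power[OF Q] by blast
      moreover have "measure (path_space Q) (A m) \<le> measure (path_space Q) (\<Union>m. A m)"
        using A'[OF Q'] by (intro q.finite_measure_mono) auto
      ultimately show "1 \<le> measure (path_space Q) (\<Union>m. A m) + e"
        by linarith
    qed
    then show ?thesis
      using q.prob_le_1 unfolding has_power_one_def stop[OF Q'] by (intro antisym) auto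
  qed
  ultimately show ?thesis
    unfolding testable_at_level_def sequential_test_def by (intro exI[of _ \<tau>] conjI ballI)
qed

section \<open>Separating boxes\<close>

text \<open>On \<open>F\<close> the difference is at most \<open>card F * \<eta>\<close>; off
  \<open>F\<close> it is at most the sum of the two tails. The tail of \<open>P\<close> needs no
  separate control: closeness on \<open>F\<close> forces \<open>P\<close> to put nearly as much mass
  there as \<open>Q\<close>.\<close>

lemma l1_dist_prob_vector_le:
  assumes P: "P \<in> space (prob_algebra (count_space X))" and Q: "Q \<in> space (prob_algebra (count_space X))"
    and F: "finite F" "F \<subseteq> X" and \<eta>: "\<And>x. x \<in> F \<Longrightarrow> \<bar>measure P {x} - measure Q {x}\<bar> \<le> \<eta>"
  shows "l1_dist X (prob_vector P) (prob_vector Q) \<le> 2 * (real (card F) * \<eta>) + 2 * (1 - measure Q F)"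
proof -
  interpret p: prob_space P
    using P by (simp add: space_prob_algebra)
  interpret q: prob_space Q
    using Q by (simp add: space_prob_algebra)
  have sets: "sets P = Pow X" "sets Q = Pow X"
    using P Q by (simp_all add: space_prob_algebra)
  have meas: "measure P G = (\<Sum>x\<in>G. measure P {x})" "measure Q G = (\<Sum>x\<in>G. measure Q {x})"
    if "finite G" "G \<subseteq> X" for G
    using that sets by (auto intro!: p.finite_measure_eq_sum_singleton q.finite_measure_eq_sum_singleton)
  let ?d = "\<lambda>x. \<bar>measure P {x} - measure Q {x}\<bar>"
  have dF: "(\<Sum>x\<in>F. ?d x) \<le> real (card F) * \<eta>"
    by (rule sum_bounded_above) (rule \<eta>)
  have "measure Q F - measure P F \<le> (\<Sum>x\<in>F. ?d x)"
    unfolding meas[OF F] sum_subtractf[symmetric] by (rule sum_mono) auto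
  with dF have PF: "measure Q F - measure P F \<le> real (card F) * \<eta>"
    by simp
  show ?thesis
    unfolding l1_dist_def l1_norm_def
  proof (rule infsum_le_finite_sums)
    show "(\<lambda>x. \<bar>prob_vector P x - prob_vector Q x\<bar>) summable_on X"
      using P Q by (intro l1_diff_summable prob_vector_in_l1_space)
    \<comment> \<open>An arbitrary finite partial sum is split into its terms in \<open>F\<close>
      and those outside, after enlarging the index set to contain \<open>F\<close>.\<close>
    fix G assume G: "finite G" "G \<subseteq> X"
    have "(\<Sum>x\<in>G. ?d x) \<le> (\<Sum>x\<in>F \<union> (G - F). ?d x)"
      using F G by (intro sum_mono2) auto
    also have "\<dots> = (\<Sum>x\<in>F. ?d x) + (\<Sum>x\<in>G - F. ?d x)"
      using F G by (intro sum.union_disjoint) auto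
    also have "(\<Sum>x\<in>G - F. ?d x) \<le> (\<Sum>x\<in>G - F. measure P {x} + measure Q {x})"
      by (intro sum_mono) (simp add: abs_le_iff add_increasing add_increasing2)
    also have "\<dots> = measure P (G - F) + measure Q (G - F)"
      using G by (subst (1 2) meas) (auto simp: sum.distrib)
    also have "\<dots> \<le> measure P (space P - F) + measure Q (space Q - F)"
      using sets G sets_eq_imp_space_eq[of P "count_space X"] sets_eq_imp_space_eq[of Q "count_space X"]
      by (intro add_mono p.finite_measure_mono q.finite_measure_mono) auto
    also have "\<dots> = (1 - measure P F) + (1 - measure Q F)"
      using F sets by (simp add: p.prob_compl q.prob_compl)
    finally show "(\<Sum>x\<in>G. \<bar>prob_vector P x - prob_vector Q x\<bar>) \<le> 2 * (real (card F) * \<eta>) + 2 * (1 - measure Q F)"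
      using dF PF by (simp add: prob_vector_def)
  qed
qed

text \<open>
  Centre and half-width are rational, so that there are only countably many boxes.  The enlargement
  factor grows with the number of coordinates so that the Euclidean distance to the centre still
  separates \<open>\<PP>\<close> from the box.  If \<open>X\<close> is finite, \<open>from_nat_into X\<close> repeats points, which is harmless.
\<close>

definition in_box :: "'a set \<Rightarrow> 'a measure \<Rightarrow> rat list \<Rightarrow> rat \<Rightarrow> bool" where
  "in_box X Q l c \<longleftrightarrow>
     (\<forall>i<length l. \<bar>measure Q {from_nat_into X i} - of_rat (l ! i)\<bar> < of_rat c)"

definition separating_box :: "'a set \<Rightarrow> 'a measure set \<Rightarrow> rat list \<Rightarrow> rat \<Rightarrow> bool" where
  "separating_box X \<PP> l c \<longleftrightarrow> 0 < c \<and>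
     (\<forall>P\<in>\<PP>. \<exists>i<length l. (length l + 3) * of_rat c \<le> \<bar>measure P {from_nat_into X i} - of_rat (l ! i)\<bar>)"

lemma prob_algebra_count_space_nonempty:
  assumes "R \<in> space (prob_algebra (count_space X))"
  shows "X \<noteq> {}"
proof -
  interpret prob_space R
    using assms by (simp add: space_prob_algebra)
  show ?thesis
    using assms not_empty sets_eq_imp_space_eq[of R "count_space X"] by (auto simp: space_prob_algebra)
qed

text \<open>Finitely many points carry almost all of \<open>Q\<close>. A null law close to
  \<open>Q\<close> at all of them would be close in l1, so each null law differs from
  \<open>Q\<close> by more than \<open>\<eta>\<close> at one of them. A rational box around
  \<open>Q\<close>, small relative to \<open>\<eta>\<close>, then separates.\<close>

lemma ex_separating_box:
  assumes "countable X" and \<PP>: "\<PP> \<subseteq> space (prob_algebra (count_space X))"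
    and Q: "Q \<in> space (prob_algebra (count_space X))"
    and notin: "prob_vector Q \<notin> l1_closure X (prob_vector ` \<PP>)"
  shows "\<exists>l c. separating_box X \<PP> l c \<and> in_box X Q l c"
proof -
  interpret q: prob_space Q
    using Q by (simp add: space_prob_algebra)
  have X: "X \<noteq> {}"
    by (rule prob_algebra_count_space_nonempty[OF Q])
  have sets: "sets Q = Pow X" and space: "space Q = X"
    using Q sets_eq_imp_space_eq[of Q "count_space X"] by (auto simp: space_prob_algebra)
  let ?e = "from_nat_into X"
  have e: "?e i \<in> X" for i
    using X by (rule from_nat_into)
  obtain \<epsilon> where "\<epsilon> > 0" and far: "\<And>P. P \<in> \<PP> \<Longrightarrow> \<epsilon> \<le> l1_dist X (prob_vector Q) (prob_vector P)"
    using notin prob_vector_in_l1_space \<PP> Q by (subst (asm) notin_l1_closure_iff) auto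
  have "(\<lambda>n. measure Q (?e ` {..<n})) \<longlonglongrightarrow> measure Q (\<Union>n. ?e ` {..<n})"
    using e sets by (intro q.finite_Lim_measure_incseq) (auto simp: incseq_def)
  also have "(\<Union>n. ?e ` {..<n}) = X"
  proof -
    have "(\<Union>n. ?e ` {..<n}) = range ?e"
      by auto
    then show ?thesis
      using range_from_nat_into[OF X \<open>countable X\<close>] by simp
  qed
  also have "measure Q X = 1"
    using q.prob_space by (simp add: space)
  finally have "\<forall>\<^sub>F n in sequentially. 1 - \<epsilon> / 4 < measure Q (?e ` {..<n})"
    using \<open>\<epsilon> > 0\<close> by (intro order_tendstoD) auto
  then obtain n where n: "1 - \<epsilon> / 4 < measure Q (?e ` {..<n})"
    by (meson eventually_sequentially order_refl)
  \<comment> \<open>With this \<open>\<eta>\<close> and the tail bound for \<open>n\<close>, both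
    terms of \<open>l1_dist_prob_vector_le\<close> are below \<open>\<epsilon> / 2\<close>. The
    added 4 keeps the denominator positive at \<open>n = 0\<close>.\<close>
  define \<eta> where "\<eta> = \<epsilon> / (4 * n + 4)"
  have "\<eta> > 0" and n\<eta>: "n * \<eta> < \<epsilon> / 4"
    using \<open>\<epsilon> > 0\<close> by (auto simp: \<eta>_def field_simps)
  have sep: "\<exists>i<n. \<eta> < \<bar>measure P {?e i} - measure Q {?e i}\<bar>" if P: "P \<in> \<PP>" for P
  proof (rule ccontr)
    assume "\<not> ?thesis"
    then have "l1_dist X (prob_vector P) (prob_vector Q) \<le>
        2 * (real (card (?e ` {..<n})) * \<eta>) + 2 * (1 - measure Q (?e ` {..<n}))"
      using \<PP> P Q e by (intro l1_dist_prob_vector_le) (auto simp: not_less linorder_not_le[symmetric])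
    \<comment> \<open>Repetitions in the enumeration can only decrease the cardinality.\<close>
    moreover have "real (card (?e ` {..<n})) * \<eta> < \<epsilon> / 4"
      using card_image_le[of "{..<n}" ?e] \<open>\<eta> > 0\<close>
      by (intro le_less_trans[OF mult_right_mono n\<eta>]) auto
    moreover have "l1_dist X (prob_vector P) (prob_vector Q) = l1_dist X (prob_vector Q) (prob_vector P)"
      by (rule Metric_space.commute[OF Metric_space_l1])
    ultimately show False
      using far[OF P] n by argo
  qed
  \<comment> \<open>One \<open>c\<close> is spent on replacing the values of \<open>Q\<close> by
    rational centres; the remaining \<open>n + 3\<close> match the factor
    \<open>length l + 3\<close>.\<close>
  obtain c :: rat where c: "0 < real_of_rat c" "real_of_rat c < \<eta> / (n + 4)"
    using of_rat_dense[of 0 "\<eta> / (n + 4)"] \<open>\<eta> > 0\<close> by auto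
  have "\<exists>r. \<bar>measure Q {?e i} - of_rat r\<bar> < real_of_rat c" for i
  proof -
    have "measure Q {?e i} < measure Q {?e i} + of_rat c"
      using c(1) by simp
    then obtain r where "measure Q {?e i} < of_rat r" "of_rat r < measure Q {?e i} + of_rat c"
      using of_rat_dense by blast
    then have "\<bar>measure Q {?e i} - of_rat r\<bar> < real_of_rat c"
      unfolding abs_less_iff by argo
    then show ?thesis ..
  qed
  then obtain r where r: "\<And>i. \<bar>measure Q {?e i} - of_rat (r i)\<bar> < real_of_rat c"
    by metis
  have c': "(real n + 3) * of_rat c \<le> \<eta> - of_rat c"
    using c(2) by (simp add: field_simps)
  define l where "l = map r [0..<n]"
  have l: "length l = n" "\<And>i. i < n \<Longrightarrow> l ! i = r i"
    by (auto simp: l_def)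
  have "\<exists>i<length l. (length l + 3) * of_rat c \<le> \<bar>measure P {?e i} - of_rat (l ! i)\<bar>"
    if P: "P \<in> \<PP>" for P
  proof -
    obtain i where i: "i < n" "\<eta> < \<bar>measure P {?e i} - measure Q {?e i}\<bar>"
      using sep[OF P] by blast
    have "(length l + 3) * of_rat c \<le> \<bar>measure P {?e i} - of_rat (l ! i)\<bar>"
      using c' r[of i] i(2) l(2)[OF i(1)] l(1) by simp
    with i(1) l(1) show ?thesis
      by blast
  qed
  then have "separating_box X \<PP> l c"
    using c(1) by (simp add: separating_box_def)
  moreover have "in_box X Q l c"
    using r l by (auto simp: in_box_def)
  ultimately show ?thesis
    by blast
qed

section \<open>Quadratic kernels on pairs of observations\<close>

definition box_kernel :: "'a set \<Rightarrow> rat list \<Rightarrow> rat \<Rightarrow> 'a \<Rightarrow> 'a \<Rightarrow> real" where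
  "box_kernel X l c x y = ((length l + 3) * of_rat c)\<^sup>2 -
     (\<Sum>i<length l. (indicator {from_nat_into X i} x - of_rat (l ! i)) *
        (indicator {from_nat_into X i} y - of_rat (l ! i)))"

lemma box_kernel_commute: "box_kernel X l c x y = box_kernel X l c y x"
  by (simp add: box_kernel_def mult.commute)

lemma bounded_box_kernel: "bounded {box_kernel X l c x y | x y. x \<in> X \<and> y \<in> X}"
proof (rule boundedI)
  fix z assume "z \<in> {box_kernel X l c x y | x y. x \<in> X \<and> y \<in> X}"
  then obtain x y where z: "z = box_kernel X l c x y"
    by blast
  have u: "\<bar>indicator {e} x - r\<bar> \<le> 1 + \<bar>r\<bar>" for e x :: 'a and r :: real
    by (cases "x = e"; simp; linarith)
  have "\<bar>z\<bar> \<le> \<bar>((length l + 3) * of_rat c)\<^sup>2\<bar> +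
      \<bar>\<Sum>i<length l. (indicator {from_nat_into X i} x - of_rat (l ! i)) *
        (indicator {from_nat_into X i} y - of_rat (l ! i))\<bar>"
    unfolding z box_kernel_def by (rule abs_triangle_ineq4)
  also have "\<dots> \<le> \<bar>((length l + 3) * of_rat c)\<^sup>2\<bar> +
      (\<Sum>i<length l. (1 + \<bar>of_rat (l ! i)\<bar>) * (1 + \<bar>of_rat (l ! i)\<bar>))"
    by (intro add_left_mono order_trans[OF sum_abs] sum_mono) (simp only: abs_mult, intro mult_mono u, auto)
  finally show "norm z \<le> \<bar>((length l + 3) * of_rat c)\<^sup>2\<bar> +
      (\<Sum>i<length l. (1 + \<bar>of_rat (l ! i)\<bar>) * (1 + \<bar>of_rat (l ! i)\<bar>))"
    by simp
qed

lemma block_expectation_prod: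
  fixes u :: "'a \<Rightarrow> real"
  assumes R: "R \<in> space (prob_algebra M)" and u: "integrable R u"
  shows "integrable (block_space R n) (\<lambda>\<omega>. \<Prod>t<n. u (\<omega> t))"
    and "block_expectation R n (\<lambda>\<omega>. \<Prod>t<n. u (\<omega> t)) = (\<integral>x. u x \<partial>R) ^ n"
proof -
  interpret prob_space R
    using R by (simp add: space_prob_algebra)
  interpret product_sigma_finite "\<lambda>_::nat. R" ..
  show "integrable (block_space R n) (\<lambda>\<omega>. \<Prod>t<n. u (\<omega> t))"
    unfolding block_space_def by (rule product_integrable_prod) (use u in auto)
  show "block_expectation R n (\<lambda>\<omega>. \<Prod>t<n. u (\<omega> t)) = (\<integral>x. u x \<partial>R) ^ n"
    unfolding block_expectation_def block_space_def
    by (subst product_integral_prod) (use u in auto)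
qed

text \<open>By independence the mean of each product is the square of the mean of one centred
  indicator. A function of one observation has mean linear in the law, so a squared distance calls
  for a pair.\<close>

lemma block_expectation_box_kernel:
  assumes R: "R \<in> space (prob_algebra (count_space X))"
  shows "block_expectation R 2 (\<lambda>\<omega>. box_kernel X l c (\<omega> 0) (\<omega> 1)) =
    ((length l + 3) * of_rat c)\<^sup>2 - (\<Sum>i<length l. (measure R {from_nat_into X i} - of_rat (l ! i))\<^sup>2)"
proof -
  interpret prob_space R
    using R by (simp add: space_prob_algebra)
  interpret b: prob_space "block_space R 2"
    by (rule prob_space_block_space[OF R])
  have sets: "sets R = Pow X" and space: "space R = X"
    using R sets_eq_imp_space_eq[of R "count_space X"] by (auto simp: space_prob_algebra)
  let ?u = "\<lambda>i x. indicator {from_nat_into X i} x - real_of_rat (l ! i)"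
  have e: "from_nat_into X i \<in> X" for i
    by (rule from_nat_into[OF prob_algebra_count_space_nonempty[OF R]])
  then have "{from_nat_into X i} \<in> sets R" for i
    by (simp add: sets)
  then have int: "integrable R (?u i)" for i
    by (intro Bochner_Integration.integrable_diff integrable_const) (auto simp: emeasure_eq_measure)
  have mean: "(\<integral>x. ?u i x \<partial>R) = measure R {from_nat_into X i} - of_rat (l ! i)" for i
    using e[of i] \<open>\<And>i. {from_nat_into X i} \<in> sets R\<close>
    by (subst Bochner_Integration.integral_diff) (auto simp: emeasure_eq_measure prob_space[unfolded space] space)
  note prod = block_expectation_prod[OF R int, of 2, unfolded mean]
  have prod2: "(\<Prod>t<2. f t) = f 0 * f 1" for f :: "nat \<Rightarrow> real"
    by (simp add: numeral_2_eq_2)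
  show ?thesis
    using prod unfolding prod2 block_expectation_def box_kernel_def
    by (simp add: b.prob_space)
qed

text \<open>The one coordinate in which the null law is far from the centre already contributes the
  full squared radius.\<close>

lemma block_expectation_box_kernel_nonpos:
  assumes "P \<in> \<PP>" "P \<in> space (prob_algebra (count_space X))" "separating_box X \<PP> l c"
  shows "block_expectation P 2 (\<lambda>\<omega>. box_kernel X l c (\<omega> 0) (\<omega> 1)) \<le> 0"
proof -
  let ?v = "\<lambda>i. measure P {from_nat_into X i} - of_rat (l ! i)"
  obtain i where i: "i < length l" "(length l + 3) * of_rat c \<le> \<bar>?v i\<bar>" and "0 < c"
    using assms by (auto simp: separating_box_def)
  then have "((length l + 3) * of_rat c)\<^sup>2 \<le> \<bar>?v i\<bar>\<^sup>2"
    by (intro power_mono) auto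
  also have "\<dots> \<le> (\<Sum>i<length l. (?v i)\<^sup>2)"
    using i(1) member_le_sum[of i "{..<length l}" "\<lambda>i. (?v i)\<^sup>2"] by simp
  finally show ?thesis
    by (simp only: block_expectation_box_kernel[OF assms(2)] diff_le_0_iff_le)
qed

text \<open>Inside the box the squared Euclidean distance is at most \<open>length l\<close> times
  the squared half-width, which is below the squared radius because \<open>length l\<close> is less
  than \<open>(length l + 3)\<^sup>2\<close>.\<close>

lemma block_expectation_box_kernel_pos:
  assumes "Q \<in> space (prob_algebra (count_space X))" "in_box X Q l c" "0 < c"
  shows "0 < block_expectation Q 2 (\<lambda>\<omega>. box_kernel X l c (\<omega> 0) (\<omega> 1))"
proof -
  let ?v = "\<lambda>i. measure Q {from_nat_into X i} - of_rat (l ! i)"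
  have c: "0 < real_of_rat c"
    using assms by simp
  have "(?v i)\<^sup>2 \<le> (of_rat c)\<^sup>2" if "i < length l" for i
    using assms(2) that power_mono[of "\<bar>?v i\<bar>" "of_rat c" 2] by (auto simp: in_box_def less_imp_le)
  then have "(\<Sum>i<length l. (?v i)\<^sup>2) \<le> (\<Sum>i<length l. (real_of_rat c)\<^sup>2)"
    by (intro sum_mono) auto
  also have "\<dots> = length l * (real_of_rat c)\<^sup>2"
    by simp
  also have "\<dots> < (real (length l) + 3)\<^sup>2 * (real_of_rat c)\<^sup>2"
    using c by (intro mult_strict_right_mono) (auto simp: power2_eq_square algebra_simps add_pos_nonneg)
  finally show ?thesis
    by (simp only: block_expectation_box_kernel[OF assms(1)] power_mult_distrib diff_gt_0_iff_gt
        of_nat_add of_nat_numeral)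
qed

text \<open>Countability makes the product sigma-algebra on pairs the full power set, so an
  arbitrary \<open>h m\<close> is measurable.\<close>

lemma sequentially_testable_blocks_of_pair_kernels:
  fixes h :: "nat \<Rightarrow> 'a \<Rightarrow> 'a \<Rightarrow> real"
  assumes "countable X"
    and bounded: "\<And>m. bounded {h m x y | x y. x \<in> X \<and> y \<in> X}"
    and null: "\<And>m P. P \<in> \<PP> \<Longrightarrow> block_expectation P 2 (\<lambda>\<omega>. h m (\<omega> 0) (\<omega> 1)) \<le> 0"
    and pos: "\<And>Q. Q \<in> \<QQ> \<Longrightarrow> \<exists>m. 0 < block_expectation Q 2 (\<lambda>\<omega>. h m (\<omega> 0) (\<omega> 1))"
  shows "sequentially_testable_blocks (count_space X) \<PP> \<QQ>"
proof -
  let ?M = "block_space (count_space X) 2"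
  have comp: "(\<lambda>\<omega>. \<omega> i) \<in> ?M \<rightarrow>\<^sub>M count_space X" if "i < 2" for i
    unfolding block_space_def by (rule measurable_component_singleton) (use that in simp)
  have pair: "(\<lambda>\<omega>. (\<omega> 0, \<omega> 1)) \<in> ?M \<rightarrow>\<^sub>M count_space (X \<times> X)"
    using measurable_Pair[OF comp[of 0] comp[of 1]]
    by (simp add: pair_measure_countable[OF \<open>countable X\<close> \<open>countable X\<close>])
  have "null_block_function (count_space X) \<PP> 2 (\<lambda>\<omega>. h m (\<omega> 0) (\<omega> 1))" for m
    unfolding null_block_function_def
  proof (intro conjI ballI null)
    show "(\<lambda>\<omega>. h m (\<omega> 0) (\<omega> 1)) \<in> borel_measurable ?M"
      using measurable_compose[OF pair, of "\<lambda>(x, y). h m x y" borel] by simp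
    have "(\<lambda>\<omega>. h m (\<omega> 0) (\<omega> 1)) ` space ?M \<subseteq> {h m x y | x y. x \<in> X \<and> y \<in> X}"
      using measurable_space[OF comp] by fastforce
    then show "bounded ((\<lambda>\<omega>. h m (\<omega> 0) (\<omega> 1)) ` space ?M)"
      by (rule bounded_subset[OF bounded])
  qed simp
  with pos show ?thesis
    unfolding sequentially_testable_blocks_def
    by (intro exI[of _ "\<lambda>_. 2"] exI[of _ "\<lambda>m \<omega>. h m (\<omega> 0) (\<omega> 1)"]) simp
qed

lemma ex_symmetric_kernels:
  assumes "countable X" and \<PP>: "\<PP> \<subseteq> space (prob_algebra (count_space X))"
    and \<QQ>: "\<QQ> \<subseteq> space (prob_algebra (count_space X))"
    and notin: "\<forall>Q\<in>\<QQ>. prob_vector Q \<notin> l1_closure X (prob_vector ` \<PP>)"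
  shows "\<exists>h :: nat \<Rightarrow> 'a \<Rightarrow> 'a \<Rightarrow> real.
     (\<forall>m. bounded {h m x y | x y. x \<in> X \<and> y \<in> X} \<and>
          (\<forall>x\<in>X. \<forall>y\<in>X. h m x y = h m y x) \<and>
          (\<forall>P\<in>\<PP>. block_expectation P 2 (\<lambda>\<omega>. h m (\<omega> 0) (\<omega> 1)) \<le> 0)) \<and>
     (\<forall>Q\<in>\<QQ>. \<exists>m. 0 < block_expectation Q 2 (\<lambda>\<omega>. h m (\<omega> 0) (\<omega> 1)))"
proof -
  \<comment> \<open>All pairs of centre and half-width are enumerated. Codes of non-separating boxes
    get the zero kernel, which keeps the null condition true for every \<open>m\<close>.\<close>
  define h where "h m = (case from_nat m of (l, c) \<Rightarrow>
      if separating_box X \<PP> l c then box_kernel X l c else (\<lambda>_ _. 0))" for m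
  have h: "(\<exists>l c. separating_box X \<PP> l c \<and> h m = box_kernel X l c) \<or> h m = (\<lambda>_ _. 0)" for m
    by (auto simp: h_def split: prod.splits)
  have "bounded {h m x y | x y. x \<in> X \<and> y \<in> X}" for m
  proof -
    have "bounded {0 :: real | x y. x \<in> X \<and> y \<in> X}"
      by (rule bounded_subset[of "{0}"]) auto
    then show ?thesis
      using h[of m] bounded_box_kernel by auto
  qed
  moreover have "h m x y = h m y x" for m x y
    using h[of m] box_kernel_commute by metis
  moreover have "block_expectation P 2 (\<lambda>\<omega>. h m (\<omega> 0) (\<omega> 1)) \<le> 0" if "P \<in> \<PP>" for P m
    using h[of m]
  proof
    assume "\<exists>l c. separating_box X \<PP> l c \<and> h m = box_kernel X l c"
    then obtain l c where lc: "separating_box X \<PP> l c" "h m = box_kernel X l c"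
      by blast
    show ?thesis
      unfolding lc(2) by (rule block_expectation_box_kernel_nonpos[OF that _ lc(1)]) (use that \<PP> in blast)
  qed (simp add: block_expectation_def)
  moreover have "\<exists>m. 0 < block_expectation Q 2 (\<lambda>\<omega>. h m (\<omega> 0) (\<omega> 1))" if Q: "Q \<in> \<QQ>" for Q
  proof -
    obtain l c where lc: "separating_box X \<PP> l c" "in_box X Q l c"
      using ex_separating_box[OF assms(1) \<PP>] Q \<QQ> notin by blast
    have "h (to_nat (l, c)) = box_kernel X l c"
      using lc(1) by (simp add: h_def)
    moreover have "0 < block_expectation Q 2 (\<lambda>\<omega>. box_kernel X l c (\<omega> 0) (\<omega> 1))"
      using lc Q \<QQ> by (intro block_expectation_box_kernel_pos) (auto simp: separating_box_def)
    ultimately show ?thesis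
      by (intro exI[of _ "to_nat (l, c)"]) simp
  qed
  ultimately show ?thesis
    by (intro exI[of _ h] conjI allI ballI)
qed

section \<open>Tests from empirical frequencies\<close>

text \<open>Hoeffding's inequality for i.i.d. indicators, which take values in the interval from 0
  to 1.\<close>

lemma frequency_deviation_le:
  assumes R: "R \<in> space (prob_algebra M)" and A: "A \<in> sets M" and "k \<ge> 1" "\<epsilon> \<ge> 0"
  shows "measure (path_space R)
      {\<omega> \<in> space (path_space R). \<epsilon> \<le> \<bar>(\<Sum>t<k. indicator A (\<omega> t)) / k - measure R A\<bar>}
    \<le> 2 * exp (- 2 * real k * \<epsilon>\<^sup>2)"
proof -
  interpret r: prob_space R
    using R by (simp add: space_prob_algebra)
  interpret product_prob_space "\<lambda>_::nat. R" UNIV ..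
  have A': "A \<in> sets R"
    using A R by (simp add: space_prob_algebra)
  let ?X = "\<lambda>t \<omega>. indicator A (\<omega> t) :: real"
  have comp: "distr (path_space R) R (\<lambda>\<omega>. \<omega> t) = R" for t
    unfolding path_space_def by (rule PiM_component) simp
  have meas [measurable]: "(\<lambda>\<omega>. \<omega> t) \<in> path_space R \<rightarrow>\<^sub>M R" for t
    unfolding path_space_def by simp
  have ind [measurable]: "(indicator A :: _ \<Rightarrow> real) \<in> borel_measurable R"
    using A' by simp
  interpret p: prob_space "path_space R"
    by (rule prob_space_path_space[OF R])
  have distr: "distr (path_space R) borel (?X t) = distr R borel (indicator A)" for t
    using distr_distr[OF ind meas, of t] by (simp add: comp comp_def)
  \<comment> \<open>Independence of the coordinates amounts to their joint law being the product of
    their marginals.\<close>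
  have "p.indep_vars (\<lambda>_. R) (\<lambda>t \<omega>. \<omega> t) UNIV"
    by (subst p.indep_vars_iff_distr_eq_PiM')
       (auto simp: comp path_space_def[symmetric] restrict_UNIV)
  then have "p.indep_vars (\<lambda>_. R) (\<lambda>t \<omega>. \<omega> t) {..<k}"
    by (rule p.indep_vars_subset) auto
  then have indep: "p.indep_vars (\<lambda>_. borel) ?X {..<k}"
    by (rule p.indep_vars_compose2) (rule ind)
  interpret H: Hoeffding_ineq_iid "path_space R" "{..<k}" ?X "?X 0" 0 1 "p.expectation (?X 0)"
    by unfold_locales (auto simp: distr indep)
  have "p.expectation (?X 0) = (\<integral>x. indicator A x \<partial>distr (path_space R) R (\<lambda>\<omega>. \<omega> 0))"
    by (rule integral_distr[symmetric]) auto
  also have "\<dots> = measure R A"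
    using sets.sets_into_space[OF A'] by (simp add: comp Int_absorb2)
  finally have mean: "p.expectation (?X 0) = measure R A" .
  have ne: "{..<k} \<noteq> {}"
    using \<open>k \<ge> 1\<close> by (simp add: lessThan_empty_iff)
  show ?thesis
    using H.Hoeffding_ineq_abs_ge'[OF \<open>\<epsilon> \<ge> 0\<close> zero_less_one ne] unfolding mean by simp
qed

text \<open>The half-width \<open>2 * of_rat c\<close> lies midway: a law in the box is within
  \<open>c\<close> of the centre, while a null law is at least \<open>3 * c\<close> away in some
  coordinate. Either way a wrong outcome requires a frequency to deviate by at least
  \<open>c\<close>.\<close>

definition box_event :: "'a set \<Rightarrow> rat list \<Rightarrow> rat \<Rightarrow> nat \<Rightarrow> (nat \<Rightarrow> 'a) set" where
  "box_event X l c k = {\<omega> \<in> space (path_space (count_space X)).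
     \<forall>i<length l. \<bar>(\<Sum>t<k. indicator {from_nat_into X i} (\<omega> t)) / k - of_rat (l ! i)\<bar> < 2 * of_rat c}"

lemma borel_measurable_frequency_deviation:
  assumes "\<And>t. t < k \<Longrightarrow> (\<lambda>\<omega>. \<omega> t) \<in> F \<rightarrow>\<^sub>M count_space X"
  shows "(\<lambda>\<omega>. \<bar>(\<Sum>t<k. indicator {x} (\<omega> t)) / real k - r\<bar>) \<in> borel_measurable F"
proof -
  have "(indicator {x} :: 'a \<Rightarrow> real) \<in> count_space X \<rightarrow>\<^sub>M borel"
    by (simp only: measurable_count_space_eq1 space_borel Pi_UNIV UNIV_I)
  then have "(\<lambda>\<omega>. indicator {x} (\<omega> t) :: real) \<in> borel_measurable F" if "t < k" for t
    by (rule measurable_compose[OF assms[OF that]])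
  then have "(\<lambda>\<omega>. \<Sum>t<k. indicator {x} (\<omega> t) :: real) \<in> borel_measurable F"
    by (rule borel_measurable_sum) (simp only: lessThan_iff)
  then show ?thesis
    by (intro borel_measurable_abs borel_measurable_diff borel_measurable_divide borel_measurable_const)
qed

lemma box_event_in_coordinate_filtration:
  "box_event X l c k \<in> sets (coordinate_filtration (count_space X) (enat k))"
proof -
  let ?F = "coordinate_filtration (count_space X) (enat k)"
  let ?g = "\<lambda>i \<omega>. \<bar>(\<Sum>t<k. indicator {from_nat_into X i} (\<omega> t)) / k - real_of_rat (l ! i)\<bar>"
  have "?g i \<in> borel_measurable ?F" for i
    by (rule borel_measurable_frequency_deviation[OF measurable_coordinate])
  then have "{\<omega> \<in> space ?F. ?g i \<omega> < 2 * of_rat c} \<in> sets ?F" for i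
    unfolding borel_measurable_iff_less by blast
  then have "{\<omega> \<in> space ?F. \<forall>i\<in>{..<length l}. ?g i \<omega> < 2 * of_rat c} \<in> sets ?F"
    by (intro sets.sets_Collect_finite_All finite_lessThan)
  also have "{\<omega> \<in> space ?F. \<forall>i\<in>{..<length l}. ?g i \<omega> < 2 * of_rat c} = box_event X l c k"
    by (simp add: box_event_def Ball_def)
  finally show ?thesis .
qed

lemma frequency_deviation_point:
  assumes R: "R \<in> space (prob_algebra (count_space X))" and "k \<ge> 1" "\<epsilon> \<ge> 0"
  shows "{\<omega> \<in> space (path_space (count_space X)).
      \<epsilon> \<le> \<bar>(\<Sum>t<k. indicator {from_nat_into X i} (\<omega> t)) / k - measure R {from_nat_into X i}\<bar>}
      \<in> sets (path_space R)" (is "?D \<in> _")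
    and "measure (path_space R) {\<omega> \<in> space (path_space (count_space X)).
      \<epsilon> \<le> \<bar>(\<Sum>t<k. indicator {from_nat_into X i} (\<omega> t)) / k - measure R {from_nat_into X i}\<bar>}
    \<le> 2 * exp (- 2 * real k * \<epsilon>\<^sup>2)"
proof -
  have e: "from_nat_into X i \<in> X"
    by (rule from_nat_into[OF prob_algebra_count_space_nonempty[OF R]])
  have space: "space (path_space R) = space (path_space (count_space X))"
    by (rule sets_eq_imp_space_eq[OF sets_path_space[OF R]])
  show "measure (path_space R) ?D \<le> 2 * exp (- 2 * real k * \<epsilon>\<^sup>2)"
    using frequency_deviation_le[OF R _ assms(2,3), of "{from_nat_into X i}"] e by (simp add: space)
  have "(\<lambda>\<omega>. \<omega> t) \<in> path_space (count_space X) \<rightarrow>\<^sub>M count_space X" for t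
    unfolding path_space_def by (rule measurable_component_singleton) simp
  note dev = borel_measurable_frequency_deviation[OF this, where k = k and x = "from_nat_into X i" and r = "measure R {from_nat_into X i}"]
  have "?D \<in> sets (path_space (count_space X))"
    using dev unfolding borel_measurable_iff_ge by (rule spec)
  then show "?D \<in> sets (path_space R)"
    by (simp only: sets_path_space[OF R])
qed

text \<open>A single separating coordinate suffices: on the event its frequency is within
  \<open>2 * c\<close> of the centre, hence at least \<open>c\<close> away from its mean.\<close>

lemma box_event_null_le:
  assumes "P \<in> \<PP>" and P: "P \<in> space (prob_algebra (count_space X))"
    and sep: "separating_box X \<PP> l c" and k: "k \<ge> 1"
  shows "measure (path_space P) (box_event X l c k) \<le> 2 * exp (- 2 * real k * (of_rat c)\<^sup>2)"
proof -
  interpret p: prob_space "path_space P"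
    by (rule prob_space_path_space[OF P])
  obtain i where i: "i < length l"
      "(length l + 3) * of_rat c \<le> \<bar>measure P {from_nat_into X i} - of_rat (l ! i)\<bar>" and c: "0 < real_of_rat c"
    using sep \<open>P \<in> \<PP>\<close> by (auto simp: separating_box_def)
  have "3 * real_of_rat c \<le> (length l + 3) * of_rat c"
    using c by (intro mult_right_mono) auto
  then have far: "3 * of_rat c \<le> \<bar>measure P {from_nat_into X i} - of_rat (l ! i)\<bar>"
    using i(2) by linarith
  let ?D = "{\<omega> \<in> space (path_space (count_space X)). of_rat c \<le>
      \<bar>(\<Sum>t<k. indicator {from_nat_into X i} (\<omega> t)) / k - measure P {from_nat_into X i}\<bar>}"
  have "box_event X l c k \<subseteq> ?D"
    using i(1) far by (fastforce simp: box_event_def)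
  then have "measure (path_space P) (box_event X l c k) \<le> measure (path_space P) ?D"
    by (rule p.finite_measure_mono) (rule frequency_deviation_point(1)[OF P k less_imp_le[OF c]])
  also have "\<dots> \<le> 2 * exp (- 2 * real k * (of_rat c)\<^sup>2)"
    by (rule frequency_deviation_point(2)[OF P k less_imp_le[OF c]])
  finally show ?thesis .
qed

text \<open>Outside the event some frequency is at least \<open>2 * c\<close> from the centre, hence
  at least \<open>c\<close> from its mean. A union bound over the coordinates gives the factor
  \<open>length l\<close>.\<close>

lemma box_event_alternative_ge:
  assumes Q: "Q \<in> space (prob_algebra (count_space X))"
    and box: "in_box X Q l c" and c: "0 < c" and k: "k \<ge> 1"
  shows "1 - length l * (2 * exp (- 2 * real k * (of_rat c)\<^sup>2)) \<le> measure (path_space Q) (box_event X l c k)"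
proof -
  interpret q: prob_space "path_space Q"
    by (rule prob_space_path_space[OF Q])
  have space: "space (path_space Q) = space (path_space (count_space X))"
    by (rule sets_eq_imp_space_eq[OF sets_path_space[OF Q]])
  have c': "0 \<le> real_of_rat c"
    using c by simp
  let ?D = "\<lambda>i. {\<omega> \<in> space (path_space (count_space X)). of_rat c \<le>
      \<bar>(\<Sum>t<k. indicator {from_nat_into X i} (\<omega> t)) / k - measure Q {from_nat_into X i}\<bar>}"
  note D = frequency_deviation_point[OF Q k c']
  have E: "box_event X l c k \<in> sets (path_space Q)"
    using box_event_in_coordinate_filtration
      sets_coordinate_filtration_le sets_path_space[OF Q] by blast
  have "space (path_space Q) - box_event X l c k \<subseteq> (\<Union>i<length l. ?D i)"
  proof
    fix \<omega> assume \<omega>: "\<omega> \<in> space (path_space Q) - box_event X l c k"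
    then obtain i where i: "i < length l"
      "2 * of_rat c \<le> \<bar>(\<Sum>t<k. indicator {from_nat_into X i} (\<omega> t)) / k - real_of_rat (l ! i)\<bar>"
      by (auto simp: box_event_def space not_less)
    have "\<bar>measure Q {from_nat_into X i} - of_rat (l ! i)\<bar> < real_of_rat c"
      using box i(1) by (simp add: in_box_def)
    then have "\<omega> \<in> ?D i"
      using i(2) \<omega> by (simp add: space)
    with i(1) show "\<omega> \<in> (\<Union>i<length l. ?D i)"
      by blast
  qed
  then have "measure (path_space Q) (space (path_space Q) - box_event X l c k) \<le>
      measure (path_space Q) (\<Union>i<length l. ?D i)"
    by (rule q.finite_measure_mono) (intro sets.finite_UN D(1) finite_lessThan)
  also have "\<dots> \<le> (\<Sum>i<length l. measure (path_space Q) (?D i))"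
    by (rule q.finite_measure_subadditive_finite[OF finite_lessThan]) (use D(1) in blast)
  also have "\<dots> \<le> length l * (2 * exp (- 2 * real k * (of_rat c)\<^sup>2))"
    using sum_bounded_above[of "{..<length l}" "\<lambda>i. measure (path_space Q) (?D i)", OF D(2)]
    by (simp only: card_lessThan)
  finally show ?thesis
    unfolding q.prob_compl[OF E] by argo
qed

section \<open>Choice of sample sizes and the resulting test\<close>

lemma ex_exp_minus_le:
  fixes a b \<beta> :: real
  assumes "0 < b" "0 < \<beta>"
  shows "\<exists>k::nat\<ge>1. a * (2 * exp (- 2 * real k * b)) \<le> \<beta>"
proof -
  have "(\<lambda>k::nat. a * (2 * exp (- 2 * real k * b))) \<longlonglongrightarrow> 0"
    using \<open>0 < b\<close> by real_asymp
  then have "\<forall>\<^sub>F k::nat in sequentially. a * (2 * exp (- 2 * real k * b)) < \<beta>"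
    using \<open>0 < \<beta>\<close> by (rule order_tendstoD)
  then have "\<forall>\<^sub>F k::nat in sequentially. 1 \<le> k \<and> a * (2 * exp (- 2 * real k * b)) < \<beta>"
    using eventually_ge_at_top by eventually_elim auto
  then show ?thesis
    by (auto simp: eventually_sequentially intro: less_imp_le)
qed

lemma testable_at_level_of_notin_l1_closure:
  assumes "countable X" and \<PP>: "\<PP> \<subseteq> space (prob_algebra (count_space X))"
    and \<QQ>: "\<QQ> \<subseteq> space (prob_algebra (count_space X))"
    and notin: "\<forall>Q\<in>\<QQ>. prob_vector Q \<notin> l1_closure X (prob_vector ` \<PP>)"
    and "0 < \<alpha>"
  shows "testable_at_level (count_space X) \<PP> \<QQ> \<alpha>"
proof -
  \<comment> \<open>The third component repeats every box with ever smaller error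
    \<open>1 / Suc j\<close>. This lets the supremum of the event probabilities reach 1 under an
    alternative.\<close>
  define code :: "nat \<Rightarrow> rat list \<times> rat \<times> nat" where "code = from_nat"
  define L where "L m = fst (code m)" for m
  define C where "C m = fst (snd (code m))" for m
  define J where "J m = snd (snd (code m))" for m
  \<comment> \<open>The factor \<open>length (L m) + 1\<close> dominates both 1, for the null bound,
    and \<open>length (L m)\<close>, for the alternative bound, so one sample size serves both.
    Guarding by \<open>0 < C m\<close> gives every code a time.\<close>
  have "\<exists>k\<ge>1. 0 < C m \<longrightarrow> (length (L m) + 1) * (2 * exp (- 2 * real k * (of_rat (C m))\<^sup>2)) \<le>
      min (\<alpha> / 2 ^ Suc m) (1 / Suc (J m))" for m
  proof (cases "0 < C m")
    case True
    then show ?thesis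
      using ex_exp_minus_le[of "(of_rat (C m))\<^sup>2" "min (\<alpha> / 2 ^ Suc m) (1 / Suc (J m))"] \<open>0 < \<alpha>\<close>
      by fastforce
  qed auto
  then obtain k where k: "\<And>m. 1 \<le> k m"
    and small: "\<And>m. 0 < C m \<Longrightarrow> (length (L m) + 1) * (2 * exp (- 2 * real (k m) * (of_rat (C m))\<^sup>2)) \<le>
      min (\<alpha> / 2 ^ Suc m) (1 / Suc (J m))"
    by metis
  \<comment> \<open>The empty event at a non-separating code adds nothing to the null
    probability.\<close>
  define A where "A m = (if separating_box X \<PP> (L m) (C m) then box_event X (L m) (C m) (k m) else {})" for m
  show ?thesis
  proof (rule testable_at_levelI[OF \<PP> \<QQ> k])
    show "A m \<in> sets (coordinate_filtration (count_space X) (enat (k m)))" for m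
      by (simp add: A_def box_event_in_coordinate_filtration)
    show "measure (path_space P) (A m) \<le> \<alpha> / 2 ^ Suc m" if P: "P \<in> \<PP>" for P m
    proof (cases "separating_box X \<PP> (L m) (C m)")
      case True
      let ?t = "2 * exp (- 2 * real (k m) * (of_rat (C m))\<^sup>2)"
      have "measure (path_space P) (A m) \<le> ?t"
        using box_event_null_le[OF P _ True k] P \<PP> True by (auto simp: A_def)
      also have "?t \<le> (length (L m) + 1) * ?t"
        by simp
      also have "\<dots> \<le> \<alpha> / 2 ^ Suc m"
        using small[of m] True by (simp add: separating_box_def)
      finally show ?thesis .
    qed (use \<open>0 < \<alpha>\<close> in \<open>simp add: A_def\<close>)
    show "\<exists>m. 1 - \<delta> \<le> measure (path_space Q) (A m)" if Q: "Q \<in> \<QQ>" and "\<delta> > 0" for Q \<delta>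
    proof -
      obtain l c where lc: "separating_box X \<PP> l c" "in_box X Q l c"
        using ex_separating_box[OF assms(1) \<PP>] Q \<QQ> notin by blast
      then have c: "0 < c"
        by (simp add: separating_box_def)
      obtain j where j: "1 / Suc j < \<delta>"
        using reals_Archimedean[OF \<open>\<delta> > 0\<close>] by (auto simp: inverse_eq_divide)
      define m where "m = to_nat (l, c, j)"
      have m: "L m = l" "C m = c" "J m = j"
        by (simp_all add: L_def C_def J_def code_def m_def)
      let ?t = "2 * exp (- 2 * real (k m) * (of_rat c)\<^sup>2)"
      have "length l * ?t \<le> (length l + 1) * ?t"
        by (intro mult_right_mono) auto
      also have "\<dots> \<le> 1 / Suc j"
        using small[of m] c by (simp add: m)
      finally have "1 - \<delta> \<le> 1 - length l * ?t"
        using j by linarith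
      also have "\<dots> \<le> measure (path_space Q) (A m)"
        using box_event_alternative_ge[OF _ lc(2) c k] Q \<QQ> lc(1) by (auto simp: A_def m)
      finally show ?thesis ..
    qed
  qed
qed

theorem proposition3p17:
  fixes X :: "'a set" and \<PP> \<QQ> :: "'a measure set"
  assumes "countable X"
    and "\<PP> \<subseteq> space (prob_algebra (count_space X))" and "\<PP> \<noteq> {}"
    and "\<QQ> \<subseteq> space (prob_algebra (count_space X))" and "\<QQ> \<noteq> {}"
  shows
    "(sequentially_testable_some_level (count_space X) \<PP> \<QQ> \<longleftrightarrow>
        (\<forall>Q\<in>\<QQ>. prob_vector Q \<notin> l1_closure X (prob_vector ` \<PP>))) \<and>
     (sequentially_testable_every_level (count_space X) \<PP> \<QQ> \<longleftrightarrow>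
        (\<forall>Q\<in>\<QQ>. prob_vector Q \<notin> l1_closure X (prob_vector ` \<PP>))) \<and>
     (sequentially_testable_blocks (count_space X) \<PP> \<QQ> \<longleftrightarrow>
        (\<forall>Q\<in>\<QQ>. prob_vector Q \<notin> l1_closure X (prob_vector ` \<PP>))) \<and>
     ((\<forall>Q\<in>\<QQ>. prob_vector Q \<notin> l1_closure X (prob_vector ` \<PP>)) \<longrightarrow>
        (\<exists>h :: nat \<Rightarrow> 'a \<Rightarrow> 'a \<Rightarrow> real.
           (\<forall>m. bounded {h m x y | x y. x \<in> X \<and> y \<in> X} \<and>
                (\<forall>x\<in>X. \<forall>y\<in>X. h m x y = h m y x) \<and>
                (\<forall>P\<in>\<PP>. block_expectation P 2 (\<lambda>\<omega>. h m (\<omega> 0) (\<omega> 1)) \<le> 0)) \<and>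
           (\<forall>Q\<in>\<QQ>. \<exists>m. 0 < block_expectation Q 2 (\<lambda>\<omega>. h m (\<omega> 0) (\<omega> 1))))) \<and>
     ((\<forall>Q\<in>\<QQ>. individually_block_testable (count_space X) \<PP> Q) \<longrightarrow>
        sequentially_testable_some_level (count_space X) \<PP> \<QQ> \<and>
        sequentially_testable_every_level (count_space X) \<PP> \<QQ> \<and>
        sequentially_testable_blocks (count_space X) \<PP> \<QQ>)"
proof -
  let ?M = "count_space X"
  let ?C = "\<forall>Q\<in>\<QQ>. prob_vector Q \<notin> l1_closure X (prob_vector ` \<PP>)"
  let ?some = "sequentially_testable_some_level ?M \<PP> \<QQ>"
  let ?every = "sequentially_testable_every_level ?M \<PP> \<QQ>"
  let ?blocks = "sequentially_testable_blocks ?M \<PP> \<QQ>"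
  let ?ind = "\<forall>Q\<in>\<QQ>. individually_block_testable ?M \<PP> Q"
  \<comment> \<open>The implications form two cycles through the closure condition
    \<open>?C\<close>: one by way of \<open>?every\<close> and \<open>?some\<close>, the other by
    way of \<open>?blocks\<close> and \<open>?ind\<close>. The last claim of the theorem enters the
    second cycle at \<open>?ind\<close>.\<close>
  have C_every: ?every if ?C
    using testable_at_level_of_notin_l1_closure[OF assms(1,2,4) that]
    by (simp add: sequentially_testable_every_level_def)
  have every_some: ?some if ?every
  proof -
    have "testable_at_level ?M \<PP> \<QQ> (1/2)"
      using that by (simp add: sequentially_testable_every_level_def)
    then show ?thesis
      unfolding sequentially_testable_some_level_def by (rule bexI) simp
  qed
  have some_C: ?C if some: ?some
  proof (intro ballI notI)
    fix Q assume Q: "Q \<in> \<QQ>" and cl: "prob_vector Q \<in> l1_closure X (prob_vector ` \<PP>)"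
    obtain \<alpha> where \<alpha>: "\<alpha> < 1" "testable_at_level ?M \<PP> \<QQ> \<alpha>"
      using some by (auto simp only: sequentially_testable_some_level_def greaterThanLessThan_iff)
    then obtain \<tau> where \<tau>: "sequential_test ?M \<tau>" "has_level \<tau> \<alpha> \<PP>" "\<forall>Q\<in>\<QQ>. has_power_one \<tau> Q"
      by (auto simp only: testable_at_level_def)
    have "Q \<in> space (prob_algebra ?M)"
      using Q assms(4) by (rule subsetD[rotated])
    then have "stop_prob \<tau> Q \<le> \<alpha>"
      using cl \<tau>(1,2) by (rule stop_prob_le_of_l1_closure[OF assms(1,2)])
    moreover have "stop_prob \<tau> Q = 1"
      using \<tau>(3) Q by (simp only: has_power_one_def)
    ultimately show False
      using \<alpha>(1) by simp
  qed
  have C_blocks: ?blocks if C: ?C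
  proof -
    obtain h :: "nat \<Rightarrow> 'a \<Rightarrow> 'a \<Rightarrow> real"
      where h: "(\<forall>m. bounded {h m x y | x y. x \<in> X \<and> y \<in> X} \<and>
        (\<forall>x\<in>X. \<forall>y\<in>X. h m x y = h m y x) \<and>
        (\<forall>P\<in>\<PP>. block_expectation P 2 (\<lambda>\<omega>. h m (\<omega> 0) (\<omega> 1)) \<le> 0)) \<and>
        (\<forall>Q\<in>\<QQ>. \<exists>m. 0 < block_expectation Q 2 (\<lambda>\<omega>. h m (\<omega> 0) (\<omega> 1)))"
      using ex_symmetric_kernels[OF assms(1,2,4) C] ..
    show ?thesis
      by (rule sequentially_testable_blocks_of_pair_kernels[OF assms(1), of h]) (use h in blast)+
  qed
  have blocks_ind: ?ind if blocks: ?blocks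
  proof
    fix Q assume Q: "Q \<in> \<QQ>"
    obtain n :: "nat \<Rightarrow> nat" and h :: "nat \<Rightarrow> (nat \<Rightarrow> 'a) \<Rightarrow> real"
      where "\<forall>m. null_block_function ?M \<PP> (n m) (h m)"
      and "\<forall>Q\<in>\<QQ>. \<exists>m. 0 < block_expectation Q (n m) (h m)"
      using blocks unfolding sequentially_testable_blocks_def by blast
    with Q show "individually_block_testable ?M \<PP> Q"
      unfolding individually_block_testable_def by blast
  qed
  have ind_C: ?C if ind: ?ind
  proof
    fix Q assume "Q \<in> \<QQ>"
    then show "prob_vector Q \<notin> l1_closure X (prob_vector ` \<PP>)"
      using ind assms(4) by (intro individually_block_testable_imp_notin_l1_closure[OF assms(1,2)]) blast+
  qed
  have some: "?some \<longleftrightarrow> ?C"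
    by (rule iffI[OF some_C every_some[OF C_every]])
  have every: "?every \<longleftrightarrow> ?C"
    by (rule iffI[OF some_C[OF every_some] C_every])
  have blocks: "?blocks \<longleftrightarrow> ?C"
    by (rule iffI[OF ind_C[OF blocks_ind] C_blocks])
  show ?thesis
    unfolding some every blocks
    by (intro conjI impI refl ex_symmetric_kernels[OF assms(1,2,4)]) (assumption | erule ind_C)+
qed

end
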